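(* Let $\mathscr{F}$ be an idempotent topologizing system of finite type on the commutative ring $R$ and let $\mathscr{F}'$ be the set of ideals $J$ of $R_{\mathscr{F}}$ such that $R_{\mathscr{F}}/J$, as an $R$-module, is $\mathscr{F}$-negligible. Then the map $\mathfrak{p}\mapsto\mathfrak{p}_{\mathscr{F}}$ is a bijection between the set of prime ideals of $R$ which do not belong to $\mathscr{F}$ and the set of prime ideals of $R_{\mathscr{F}}$ which do not belong to $\mathscr{F}'$.
   Context: All rings are commutative. A topologizing system on a ring $R$ is a non-empty family $\mathscr{F}$ of ideals of $R$ such that every ideal containing a member of $\mathscr{F}$ belongs to $\mathscr{F}$, and $\mathscr{F}$ is stable under finite intersections. An $R$-module $M$ is $\mathscr{F}$-negligible if $\operatorname{Ann}_R(m)\in\mathscr{F}$ for every $m\in M$. For topologizing systems $\mathscr{F},\mathscr{G}$ on $R$, $\mathscr{F}.\mathscr{G}$ is the set of ideals $I$ of $R$ for which there is $J\in\mathscr{G}$ with $I\subseteq J$ and $J/I$ $\mathscr{F}$-negligible; $\mathscr{F}$ is idempotent if $\mathscr{F}.\mathscr{F}=\mathscr{F}$. An idempotent topologizing system is of finite type if every element of it contains a finitely generated ideal belonging to the system. For an $R$-module $M$, $\mathscr{F}(M)=\{m\in M:\operatorname{Ann}_R(m)\in\mathscr{F}\}$ (a submodule), and the Gabriel localization is $M_{\mathscr{F}}=\operatorname{colim}_{I\in\mathscr{F}}\operatorname{Hom}_R(I,M/\mathscr{F}(M))$, where $\mathscr{F}$ is directed by reverse inclusion and the transition maps are restrictions;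 $[f]$ denotes the class of $f:I\to M/\mathscr{F}(M)$. The canonical map $j_M:M\to M_{\mathscr{F}}$ sends $m$ to the class of $R\to M/\mathscr{F}(M)$, $r\mapsto rm+\mathscr{F}(M)$. For an $R$-linear map $u:M\to N$, the map $u_{\mathscr{F}}:M_{\mathscr{F}}\to N_{\mathscr{F}}$ is $[f]\mapsto[\overline{u}\circ f]$, where $\overline{u}:M/\mathscr{F}(M)\to N/\mathscr{F}(N)$ is induced by $u$. $R_{\mathscr{F}}$ is a commutative ring: for $f:I\to R/\mathscr{F}(R)$ and $g:J\to R/\mathscr{F}(R)$ $R$-linear with $I,J\in\mathscr{F}$, put $\overline{J}=(J+\mathscr{F}(R))/\mathscr{F}(R)$ and $\overline{g}:\overline{J}\to R/\mathscr{F}(R)$, $b+\mathscr{F}(R)\mapsto g(b)$ for $b\in J$; then $f^{-1}(\overline{J})\in\mathscr{F}$ and $[f].[g]=[\overline{g}\circ f|_{f^{-1}(\overline{J})}]$. The unit is the class of the canonical map $R\to R/\mathscr{F}(R)$, and $j_R:R\to R_{\mathscr{F}}$ is a ring homomorphism. For an ideal $\mathfrak{p}$ of $R$ with inclusion $i:\mathfrak{p}\to R$, the map $i_{\mathscr{F}}:\mathfrak{p}_{\mathscr{F}}\to R_{\mathscr{F}}$ is injective, and its image, an ideal of $R_{\mathscr{F}}$, is also denoted $\mathfrak{p}_{\mathscr{F}}$; this is the meaning of $\mathfrak{p}_{\mathscr{F}}$ in the claim. *)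

theory Defs
  imports "HOL-Algebra.Module" "HOL-Algebra.QuotRing"
begin

section \<open>Modules over a commutative ring\<close>

text \<open>The ring \<open>S\<close> as a module over the source of a ring homomorphism \<open>h\<close> into \<open>S\<close>.\<close>

definition scalars_via :: "('a \<Rightarrow> 'b) \<Rightarrow> ('b, 'c) ring_scheme \<Rightarrow> ('a, 'b) module"
  where "scalars_via h S =
    \<lparr>carrier = carrier S, mult = mult S, one = one S, zero = zero S, add = add S,
     smult = (\<lambda>r x. h r \<otimes>\<^bsub>S\<^esub> x)\<rparr>"

definition self_module :: "('a, 'b) ring_scheme \<Rightarrow> ('a, 'a) module"
  where "self_module R = scalars_via (\<lambda>r. r) R"

definition ideal_module :: "('a, 'b) ring_scheme \<Rightarrow> 'a set \<Rightarrow> ('a, 'a) module"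
  where "ideal_module R I = (self_module R)\<lparr>carrier := I\<rparr>"

text \<open>
  The fields \<open>mult\<close> and \<open>one\<close> play no role for a module. Scalar multiplication sends
  the coset of \<open>x\<close> to the coset of \<open>r x\<close>; the union is over equal cosets.
\<close>

definition quotient_module :: "('a, 'm, 'c) module_scheme \<Rightarrow> 'm set \<Rightarrow> ('a, 'm set) module"
  where "quotient_module M N =
    \<lparr>carrier = a_rcosets\<^bsub>M\<^esub> N, mult = rcoset_mult M N, one = N +>\<^bsub>M\<^esub> \<one>\<^bsub>M\<^esub>,
     zero = N, add = set_add M,
     smult = (\<lambda>r X. \<Union>x\<in>X. N +>\<^bsub>M\<^esub> (r \<odot>\<^bsub>M\<^esub> x))\<rparr>"

text \<open>Linear maps are taken extensional, so that equality of maps is equality in HOL.\<close>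

definition module_Hom ::
    "('a, 'b) ring_scheme \<Rightarrow> ('a, 'm, 'c) module_scheme \<Rightarrow> ('a, 'n, 'd) module_scheme \<Rightarrow> ('m \<Rightarrow> 'n) set"
  where "module_Hom R M N =
    {f \<in> carrier M \<rightarrow>\<^sub>E carrier N.
       (\<forall>x\<in>carrier M. \<forall>y\<in>carrier M. f (x \<oplus>\<^bsub>M\<^esub> y) = f x \<oplus>\<^bsub>N\<^esub> f y) \<and>
       (\<forall>r\<in>carrier R. \<forall>x\<in>carrier M. f (r \<odot>\<^bsub>M\<^esub> x) = r \<odot>\<^bsub>N\<^esub> f x)}"

definition annihilator :: "('a, 'b) ring_scheme \<Rightarrow> ('a, 'm, 'c) module_scheme \<Rightarrow> 'm \<Rightarrow> 'a set"
  where "annihilator R M m = {r \<in> carrier R. r \<odot>\<^bsub>M\<^esub> m = \<zero>\<^bsub>M\<^esub>}"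


section \<open>Topologizing systems\<close>

definition topologizing_system :: "('a, 'b) ring_scheme \<Rightarrow> 'a set set \<Rightarrow> bool"
  where "topologizing_system R F \<longleftrightarrow>
    F \<noteq> {} \<and>
    (\<forall>I\<in>F. ideal I R) \<and>
    (\<forall>I\<in>F. \<forall>J. ideal J R \<and> I \<subseteq> J \<longrightarrow> J \<in> F) \<and>
    (\<forall>I\<in>F. \<forall>J\<in>F. I \<inter> J \<in> F)"

definition negligible ::
    "('a, 'b) ring_scheme \<Rightarrow> 'a set set \<Rightarrow> ('a, 'm, 'c) module_scheme \<Rightarrow> bool"
  where "negligible R F M \<longleftrightarrow> (\<forall>m\<in>carrier M. annihilator R M m \<in> F)"

definition system_product ::
    "('a, 'b) ring_scheme \<Rightarrow> 'a set set \<Rightarrow> 'a set set \<Rightarrow> 'a set set"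
  where "system_product R F G =
    {I. ideal I R \<and>
        (\<exists>J\<in>G. I \<subseteq> J \<and> negligible R F (quotient_module (ideal_module R J) I))}"

definition idempotent_system :: "('a, 'b) ring_scheme \<Rightarrow> 'a set set \<Rightarrow> bool"
  where "idempotent_system R F \<longleftrightarrow>
    topologizing_system R F \<and> system_product R F F = F"

definition finite_type_system :: "('a, 'b) ring_scheme \<Rightarrow> 'a set set \<Rightarrow> bool"
  where "finite_type_system R F \<longleftrightarrow>
    idempotent_system R F \<and>
    (\<forall>I\<in>F. \<exists>S. finite S \<and> S \<subseteq> carrier R \<and> Idl\<^bsub>R\<^esub> S \<subseteq> I \<and> Idl\<^bsub>R\<^esub> S \<in> F)"


section \<open>Gabriel localization\<close>

definition torsion ::
    "('a, 'b) ring_scheme \<Rightarrow> 'a set set \<Rightarrow> ('a, 'm, 'c) module_scheme \<Rightarrow> 'm set"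
  where "torsion R F M = {m \<in> carrier M. annihilator R M m \<in> F}"

definition torsion_quotient ::
    "('a, 'b) ring_scheme \<Rightarrow> 'a set set \<Rightarrow> ('a, 'm, 'c) module_scheme \<Rightarrow> ('a, 'm set) module"
  where "torsion_quotient R F M = quotient_module M (torsion R F M)"

text \<open>
  The directed colimit is the set of pairs \<open>(I, f)\<close>, with \<open>I \<in> F\<close> and \<open>f\<close> a linear map from \<open>I\<close>
  to \<open>M / F(M)\<close>, where two pairs are identified if the maps have the same restriction to
  some member of \<open>F\<close> contained in both domains.
\<close>

definition loc_pairs ::
    "('a, 'b) ring_scheme \<Rightarrow> 'a set set \<Rightarrow> ('a, 'm, 'c) module_scheme \<Rightarrow> ('a set \<times> ('a \<Rightarrow> 'm set)) set"
  where "loc_pairs R F M =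
    (SIGMA I : F. module_Hom R (ideal_module R I) (torsion_quotient R F M))"

definition loc_rel ::
    "('a, 'b) ring_scheme \<Rightarrow> 'a set set \<Rightarrow> ('a, 'm, 'c) module_scheme \<Rightarrow>
     (('a set \<times> ('a \<Rightarrow> 'm set)) \<times> ('a set \<times> ('a \<Rightarrow> 'm set))) set"
  where "loc_rel R F M =
    {((I, f), (J, g)). (I, f) \<in> loc_pairs R F M \<and> (J, g) \<in> loc_pairs R F M \<and>
       (\<exists>K\<in>F. K \<subseteq> I \<inter> J \<and> restrict f K = restrict g K)}"

definition loc_class ::
    "('a, 'b) ring_scheme \<Rightarrow> 'a set set \<Rightarrow> ('a, 'm, 'c) module_scheme \<Rightarrow> 'a set \<Rightarrow> ('a \<Rightarrow> 'm set) \<Rightarrow>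
     ('a set \<times> ('a \<Rightarrow> 'm set)) set"
  where "loc_class R F M I f = loc_rel R F M `` {(I, f)}"

text \<open>
  Operations on classes are defined on representatives, as unions over all representatives
  of one and the same class. The fields \<open>mult\<close> and \<open>one\<close> play no role for a module.
\<close>

definition loc_module ::
    "('a, 'b) ring_scheme \<Rightarrow> 'a set set \<Rightarrow> ('a, 'm, 'c) module_scheme \<Rightarrow>
     ('a, ('a set \<times> ('a \<Rightarrow> 'm set)) set) module"
  where "loc_module R F M =
    \<lparr>carrier = loc_pairs R F M // loc_rel R F M,
     mult = undefined,
     one = undefined,
     zero = loc_class R F M (carrier R) (\<lambda>r\<in>carrier R. \<zero>\<^bsub>torsion_quotient R F M\<^esub>),
     add = (\<lambda>X Y. \<Union>(I, f)\<in>X. \<Union>(J, g)\<in>Y.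
       loc_class R F M (I \<inter> J) (\<lambda>a\<in>I \<inter> J. f a \<oplus>\<^bsub>torsion_quotient R F M\<^esub> g a)),
     smult = (\<lambda>r X. \<Union>(I, f)\<in>X.
       loc_class R F M I (\<lambda>a\<in>I. r \<odot>\<^bsub>torsion_quotient R F M\<^esub> f a))\<rparr>"

definition loc_canonical ::
    "('a, 'b) ring_scheme \<Rightarrow> 'a set set \<Rightarrow> ('a, 'm, 'c) module_scheme \<Rightarrow> 'm \<Rightarrow>
     ('a set \<times> ('a \<Rightarrow> 'm set)) set"
  where "loc_canonical R F M m =
    loc_class R F M (carrier R) (\<lambda>r\<in>carrier R. torsion R F M +>\<^bsub>M\<^esub> (r \<odot>\<^bsub>M\<^esub> m))"

text \<open>The map \<open>M / F(M) \<rightarrow> N / F(N)\<close> induced by \<open>u : M \<rightarrow> N\<close>, on a coset \<open>X\<close>; again a union of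
  equal cosets.\<close>

definition induced_map ::
    "('a, 'b) ring_scheme \<Rightarrow> 'a set set \<Rightarrow> ('a, 'n, 'd) module_scheme \<Rightarrow> ('m \<Rightarrow> 'n) \<Rightarrow> 'm set \<Rightarrow> 'n set"
  where "induced_map R F N u X = (\<Union>x\<in>X. torsion R F N +>\<^bsub>N\<^esub> u x)"

text \<open>The source module \<open>M\<close> of \<open>u\<close> enters only through the argument \<open>X\<close>, an element of the
  localization of \<open>M\<close>.\<close>

definition loc_map ::
    "('a, 'b) ring_scheme \<Rightarrow> 'a set set \<Rightarrow> ('a, 'n, 'd) module_scheme \<Rightarrow> ('m \<Rightarrow> 'n) \<Rightarrow>
     ('a set \<times> ('a \<Rightarrow> 'm set)) set \<Rightarrow> ('a set \<times> ('a \<Rightarrow> 'n set)) set"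
  where "loc_map R F N u X =
    (\<Union>(I, f)\<in>X. loc_class R F N I (\<lambda>a\<in>I. induced_map R F N u (f a)))"


section \<open>The localized ring\<close>

text \<open>The image of \<open>J\<close> in \<open>R / F(R)\<close>, that is \<open>(J + F(R)) / F(R)\<close>.\<close>

definition ideal_image :: "('a, 'b) ring_scheme \<Rightarrow> 'a set set \<Rightarrow> 'a set \<Rightarrow> 'a set set"
  where "ideal_image R F J = (\<lambda>b. torsion R F (self_module R) +>\<^bsub>R\<^esub> b) ` J"

text \<open>The map on \<open>ideal_image R F J\<close> sending the coset of \<open>b \<in> J\<close> to \<open>g b\<close>; the union is over all
  \<open>b \<in> J\<close> representing the coset, which have the same value under \<open>g\<close>.\<close>

definition descended_map :: "'a set \<Rightarrow> ('a \<Rightarrow> 'a set) \<Rightarrow> 'a set \<Rightarrow> 'a set"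
  where "descended_map J g x = (\<Union>b\<in>x \<inter> J. g b)"

definition ideal_preimage ::
    "('a, 'b) ring_scheme \<Rightarrow> 'a set set \<Rightarrow> 'a set \<Rightarrow> ('a \<Rightarrow> 'a set) \<Rightarrow> 'a set \<Rightarrow> 'a set"
  where "ideal_preimage R F I f J = {a \<in> I. f a \<in> ideal_image R F J}"

definition loc_ring ::
    "('a, 'b) ring_scheme \<Rightarrow> 'a set set \<Rightarrow> ('a set \<times> ('a \<Rightarrow> 'a set)) set ring"
  where "loc_ring R F =
    \<lparr>carrier = carrier (loc_module R F (self_module R)),
     mult = (\<lambda>X Y. \<Union>(I, f)\<in>X. \<Union>(J, g)\<in>Y.
       loc_class R F (self_module R) (ideal_preimage R F I f J)
         (\<lambda>a\<in>ideal_preimage R F I f J. descended_map J g (f a))),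
     one = loc_class R F (self_module R) (carrier R)
       (\<lambda>r\<in>carrier R. torsion R F (self_module R) +>\<^bsub>R\<^esub> r),
     zero = zero (loc_module R F (self_module R)),
     add = add (loc_module R F (self_module R))\<rparr>"

text \<open>The localization of an ideal \<open>p\<close>, as an ideal of the localized ring: the image of the
  localization of the inclusion of \<open>p\<close> into \<open>R\<close>.\<close>

definition loc_ideal ::
    "('a, 'b) ring_scheme \<Rightarrow> 'a set set \<Rightarrow> 'a set \<Rightarrow> ('a set \<times> ('a \<Rightarrow> 'a set)) set set"
  where "loc_ideal R F p =
    loc_map R F (self_module R) (\<lambda>x. x) ` carrier (loc_module R F (ideal_module R p))"

text \<open>The quotient \<open>R\<^sub>F / J\<close> is an \<open>R\<close>-module through the canonical homomorphism \<open>R \<rightarrow> R\<^sub>F\<close>.\<close>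

definition loc_system ::
    "('a, 'b) ring_scheme \<Rightarrow> 'a set set \<Rightarrow> ('a set \<times> ('a \<Rightarrow> 'a set)) set set set"
  where "loc_system R F =
    {J. ideal J (loc_ring R F) \<and>
        negligible R F
          (quotient_module (scalars_via (loc_canonical R F (self_module R)) (loc_ring R F)) J)}"

end

theory Submission
  imports Defs
begin

text \<open>
  Write \<open>T = F(R)\<close> and \<open>j\<close> for the canonical map from \<open>R\<close> to the localized ring. An element \<open>X\<close> of
  the localized ring is known through the relation \<open>a X = x\<close> with \<open>a\<close> and \<open>x\<close> in \<open>R\<close>, which holds
  when some representative of \<open>X\<close> sends \<open>a\<close> to the coset of \<open>x\<close>. This relation, called the graph of
  \<open>X\<close>, has four decisive properties. For given \<open>X\<close>, its first components contain a member of \<open>F\<close>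
  (\<open>graph_domain\<close>); \<open>x\<close> is determined by \<open>a\<close> modulo \<open>T\<close> (\<open>graph_unique\<close>); elements
  whose graphs meet over every point of a member of \<open>F\<close> are equal (\<open>graph_eqI\<close>); and the product
  composes graphs, while the sum adds second components (\<open>graph_mult\<close>, \<open>graph_add\<close>). They reduce
  each ring axiom to a computation in \<open>R\<close> modulo \<open>T\<close>, and they give \<open>j(a) X = j(x)\<close> for each pair
  \<open>(a, x)\<close> of the graph (\<open>can_mult_graph\<close>). Idempotence of \<open>F\<close> makes \<open>R / T\<close>
  torsion-free and puts the domains of composites into \<open>F\<close>; both follow from \<open>system_local\<close>.

  If \<open>p\<close> is a prime outside \<open>F\<close>, then no member of \<open>F\<close> is contained in \<open>p\<close>. Hence \<open>p\<close> contains
  \<open>T\<close>, and the localization of \<open>p\<close> consists of the \<open>X\<close> for which \<open>I X\<close> lies in \<open>j(p)\<close> for some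
  \<open>I\<close> in \<open>F\<close> (\<open>loc_ideal_iff\<close>). If \<open>j(r)\<close> is such an element, then \<open>a r\<close> is in \<open>p\<close> for an \<open>a\<close>
  outside \<open>p\<close>, so \<open>r\<close> is in \<open>p\<close>: the localization of \<open>p\<close> contracts to \<open>p\<close>. It is prime because
  elements \<open>X\<close> and \<open>Y\<close> outside it admit \<open>a X = x\<close> and \<open>b Y = y\<close> with \<open>x\<close> and \<open>y\<close> outside \<open>p\<close>,
  whereas \<open>j(x y)\<close> is a multiple of \<open>X Y\<close>.

  Conversely, let \<open>P\<close> be a prime of the localized ring outside \<open>F'\<close>, with contraction \<open>p\<close>. If \<open>p\<close>
  were in \<open>F\<close>, the module of cosets of \<open>P\<close> would be negligible, being killed by \<open>p\<close>. An element \<open>X\<close>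
  of \<open>P\<close> satisfies \<open>a X = x\<close> with \<open>j(x)\<close> in \<open>P\<close>, so it lies in the localization of \<open>p\<close>; and if \<open>X\<close>
  lies there, then \<open>j(a) X\<close> is in \<open>P\<close> for an \<open>a\<close> outside \<open>p\<close>, so \<open>X\<close> is in \<open>P\<close>. Contraction is thus
  inverse to localization.
\<close>

section \<open>Ideals and cosets in a commutative ring\<close>

lemma (in cring) ideal_from_closure:
  assumes "N \<subseteq> carrier R" "\<zero> \<in> N"
    and add: "\<And>x y. x \<in> N \<Longrightarrow> y \<in> N \<Longrightarrow> x \<oplus> y \<in> N"
    and mult: "\<And>r x. r \<in> carrier R \<Longrightarrow> x \<in> N \<Longrightarrow> r \<otimes> x \<in> N"
  shows "ideal N R"
proof (rule idealI[OF ring_axioms])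
  have "\<ominus> x \<in> N" if "x \<in> N" for x
  proof -
    have "x \<in> carrier R" using that assms(1) by auto
    then have "\<ominus> x = (\<ominus> \<one>) \<otimes> x" by (simp add: l_minus)
    then show ?thesis using mult[of "\<ominus> \<one>" x] that by simp
  qed
  then show "subgroup N (add_monoid R)"
    using assms(1-3)
    by (intro add.subgroupI) (auto simp: a_inv_def)
  show "x \<otimes> a \<in> N" if "a \<in> N" "x \<in> carrier R" for a x
    using mult that by blast
  show "a \<otimes> x \<in> N" if "a \<in> N" "x \<in> carrier R" for a x
    using mult[OF that(2,1)] assms(1) that by (metis m_comm subsetD)
qed

lemma (in ideal) coset_eq_self_iff:
  assumes "x \<in> carrier R"
  shows "I +> x = I \<longleftrightarrow> x \<in> I"
  using assms a_coset_join1 a_coset_join2 a_subgroup by blast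

lemma (in ideal) mem_coset_iff:
  assumes "x \<in> carrier R"
  shows "y \<in> I +> x \<longleftrightarrow> y \<in> carrier R \<and> y \<ominus> x \<in> I"
  using a_rcos_module_minus[OF ring_axioms assms] a_elemrcos_carrier[OF assms] by blast

lemma (in ideal) self_mem_coset:
  assumes "x \<in> carrier R"
  shows "x \<in> I +> x"
  using assms a_rcos_self by blast

lemma (in ideal) coset_eq_iff_mem:
  assumes "x \<in> carrier R" "y \<in> carrier R"
  shows "I +> x = I +> y \<longleftrightarrow> x \<in> I +> y"
  using assms a_repr_independence'[of x y] self_mem_coset[of x] by auto

text \<open>Scalar multiplication on a quotient module is written as a union over a coset; since all
  members of the coset contribute the same coset, the union is that coset.\<close>

lemma (in ideal) union_cosets_smult:
  assumes "c \<in> carrier R" "x \<in> carrier R"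
  shows "(\<Union>y\<in>I +> x. I +> (c \<otimes> y)) = I +> (c \<otimes> x)"
proof -
  have "I +> (c \<otimes> y) = I +> (c \<otimes> x)" if "y \<in> I +> x" for y
  proof -
    have y: "y \<in> carrier R" "y \<ominus> x \<in> I" using that assms mem_coset_iff by auto
    have "c \<otimes> y \<ominus> c \<otimes> x = c \<otimes> (y \<ominus> x)"
      using y assms by (simp add: minus_eq r_distr r_minus)
    then have "c \<otimes> y \<ominus> c \<otimes> x \<in> I" using I_l_closed y assms by simp
    then show ?thesis using y assms mem_coset_iff coset_eq_iff_mem by simp
  qed
  then show ?thesis using self_mem_coset[OF assms(2)] by blast
qed

lemma (in cring) colon_ideal:
  assumes "ideal A R" "x \<in> carrier R"
  shows "ideal {s \<in> carrier R. s \<otimes> x \<in> A} R"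
proof -
  interpret A: ideal A R by fact
  show ?thesis
    using assms(2) A.I_l_closed by (intro ideal_from_closure) (auto simp: l_distr m_assoc)
qed

lemma quotient_module_simps:
  "carrier (quotient_module M N) = {N +>\<^bsub>M\<^esub> x | x. x \<in> carrier M}"
  "zero (quotient_module M N) = N"
  "add (quotient_module M N) = set_add M"
  "smult (quotient_module M N) r X = (\<Union>x\<in>X. N +>\<^bsub>M\<^esub> (r \<odot>\<^bsub>M\<^esub> x))"
  by (auto simp: quotient_module_def A_RCOSETS_def RCOSETS_def a_r_coset_def)

lemma ideal_module_simps:
  "carrier (ideal_module R I) = I"
  "zero (ideal_module R I) = zero R"
  "add (ideal_module R I) = add R"
  "smult (ideal_module R I) r x = r \<otimes>\<^bsub>R\<^esub> x"
  "a_r_coset (ideal_module R I) = a_r_coset R"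
  "set_add (ideal_module R I) = set_add R"
  by (auto simp: ideal_module_def self_module_def scalars_via_def a_r_coset_def set_add_def
      r_coset_def set_mult_def fun_eq_iff)

lemma scalars_via_simps:
  "carrier (scalars_via h S) = carrier S"
  "zero (scalars_via h S) = zero S"
  "smult (scalars_via h S) r x = h r \<otimes>\<^bsub>S\<^esub> x"
  "a_r_coset (scalars_via h S) = a_r_coset S"
  by (auto simp: scalars_via_def a_r_coset_def r_coset_def fun_eq_iff)

lemma self_module_as_ideal_module: "self_module R = ideal_module R (carrier R)"
  by (simp add: ideal_module_def self_module_def scalars_via_def)


text \<open>The module \<open>M\<close> need only have the coset operation of \<open>R\<close> and scalars acting through \<open>h\<close>. This
  covers ideals of a ring as modules over it as well as the localized ring as a module over \<open>R\<close>.\<close>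

lemma (in ideal) annihilator_coset:
  assumes "a_r_coset M = a_r_coset R" "\<And>r y. r \<odot>\<^bsub>M\<^esub> y = h r \<otimes> y"
    and "\<And>r. r \<in> carrier S \<Longrightarrow> h r \<in> carrier R" "x \<in> carrier R"
  shows "annihilator S (quotient_module M I) (I +> x) = {r \<in> carrier S. h r \<otimes> x \<in> I}"
proof -
  have "r \<odot>\<^bsub>quotient_module M I\<^esub> (I +> x) = I +> (h r \<otimes> x)" if "r \<in> carrier S" for r
    using assms(1,2,4) assms(3)[OF that] by (simp add: quotient_module_simps union_cosets_smult)
  moreover have "I +> (h r \<otimes> x) = I \<longleftrightarrow> h r \<otimes> x \<in> I" if "r \<in> carrier S" for r
    using assms(3)[OF that] assms(4) by (intro coset_eq_self_iff) simp
  ultimately have "r \<odot>\<^bsub>quotient_module M I\<^esub> (I +> x) = I \<longleftrightarrow> h r \<otimes> x \<in> I"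
    if "r \<in> carrier S" for r
    using that by presburger
  then show ?thesis
    unfolding annihilator_def quotient_module_simps(2) by (intro Collect_cong conj_cong refl)
qed


section \<open>Gabriel topologies\<close>

locale gabriel_topology = cring R for R (structure) +
  fixes F
  assumes idempotent: "idempotent_system R F"
begin

lemma topologizing:
  "F \<noteq> {} \<and> (\<forall>I\<in>F. ideal I R) \<and> (\<forall>I\<in>F. \<forall>J. ideal J R \<and> I \<subseteq> J \<longrightarrow> J \<in> F) \<and>
    (\<forall>I\<in>F. \<forall>J\<in>F. I \<inter> J \<in> F)"
  using idempotent unfolding idempotent_system_def topologizing_system_def by (rule conjunct1)

lemma system_ideal: "I \<in> F \<Longrightarrow> ideal I R"
  by (rule bspec[OF conjunct1[OF conjunct2[OF topologizing]]])

lemma system_upward: "I \<in> F \<Longrightarrow> ideal J R \<Longrightarrow> I \<subseteq> J \<Longrightarrow> J \<in> F"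
  by (rule mp[OF spec[OF bspec[OF conjunct1[OF conjunct2[OF conjunct2[OF topologizing]]]]] conjI])

lemma system_Int: "I \<in> F \<Longrightarrow> J \<in> F \<Longrightarrow> I \<inter> J \<in> F"
  by (rule bspec[OF bspec[OF conjunct2[OF conjunct2[OF conjunct2[OF topologizing]]]]])

lemma system_carrier: "I \<in> F \<Longrightarrow> a \<in> I \<Longrightarrow> a \<in> carrier R"
  by (rule ideal.Icarr[OF system_ideal])

lemma carrier_in_system: "carrier R \<in> F"
proof -
  obtain I where I: "I \<in> F" using conjunct1[OF topologizing] by auto
  show ?thesis using system_carrier[OF I] by (intro system_upward[OF I oneideal] subsetI)
qed

lemma system_zero: "I \<in> F \<Longrightarrow> \<zero> \<in> I"
  by (rule additive_subgroup.zero_closed[OF ideal.axioms(1)[OF system_ideal]])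

text \<open>For \<open>A = 0\<close> this ideal is the torsion \<open>F(R)\<close>; in general it is the preimage of the torsion
  of \<open>R / A\<close>.\<close>

lemma saturation_ideal:
  assumes A: "ideal A R"
  shows "ideal {x \<in> carrier R. {s \<in> carrier R. s \<otimes> x \<in> A} \<in> F} R" (is "ideal ?J R")
proof -
  interpret A: ideal A R by (rule A)
  show ?thesis
  proof (rule ideal_from_closure)
    show "?J \<subseteq> carrier R" by (rule Collect_restrict)
    have "{s \<in> carrier R. s \<otimes> \<zero> \<in> A} = carrier R" by auto
    then show "\<zero> \<in> ?J" using carrier_in_system by simp
  next
    fix x y assume xy: "x \<in> ?J" "y \<in> ?J"
    then have c: "x \<in> carrier R" "y \<in> carrier R" by auto
    have "{s \<in> carrier R. s \<otimes> x \<in> A} \<inter> {s \<in> carrier R. s \<otimes> y \<in> A} \<in> F"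
      using xy by (intro system_Int) auto
    moreover have "ideal {s \<in> carrier R. s \<otimes> (x \<oplus> y) \<in> A} R"
      using c by (intro colon_ideal[OF A]) simp
    moreover have "{s \<in> carrier R. s \<otimes> x \<in> A} \<inter> {s \<in> carrier R. s \<otimes> y \<in> A}
      \<subseteq> {s \<in> carrier R. s \<otimes> (x \<oplus> y) \<in> A}"
      by (auto simp: c r_distr)
    ultimately have "{s \<in> carrier R. s \<otimes> (x \<oplus> y) \<in> A} \<in> F"
      by (rule system_upward)
    then show "x \<oplus> y \<in> ?J" using c by simp
  next
    fix r x assume rx: "r \<in> carrier R" "x \<in> ?J"
    then have c: "x \<in> carrier R" and xF: "{s \<in> carrier R. s \<otimes> x \<in> A} \<in> F" by auto
    have "{s \<in> carrier R. s \<otimes> x \<in> A} \<subseteq> {s \<in> carrier R. s \<otimes> (r \<otimes> x) \<in> A}"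
      by (auto simp: c rx(1) m_lcomm[of _ r x] A.I_l_closed)
    then have "{s \<in> carrier R. s \<otimes> (r \<otimes> x) \<in> A} \<in> F"
      by (rule system_upward[OF xF, rotated]) (simp add: colon_ideal A c rx(1))
    then show "r \<otimes> x \<in> ?J" using c rx(1) by simp
  qed
qed

text \<open>This is the form in which idempotence enters: membership in \<open>F\<close> can be tested on the colon
  ideals \<open>(A : a)\<close> for \<open>a\<close> in a member \<open>I\<close> of \<open>F\<close>. The ideal \<open>J\<close> of all \<open>x\<close> with
  \<open>(A : x)\<close> in \<open>F\<close> contains \<open>I\<close>, hence lies in \<open>F\<close>, and \<open>J / A\<close> is negligible because the
  annihilator of the coset of \<open>x\<close> is \<open>(A : x)\<close>.\<close>

lemma system_local:
  assumes A: "ideal A R" and I: "I \<in> F"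
    and colon: "\<And>a. a \<in> I \<Longrightarrow> {s \<in> carrier R. s \<otimes> a \<in> A} \<in> F"
  shows "A \<in> F"
proof -
  interpret A: ideal A R by (rule A)
  define J where "J = {x \<in> carrier R. {s \<in> carrier R. s \<otimes> x \<in> A} \<in> F}"
  have J: "ideal J R" unfolding J_def by (rule saturation_ideal[OF A])
  have "I \<subseteq> J" using colon system_carrier[OF I] by (auto simp: J_def)
  then have JF: "J \<in> F" by (rule system_upward[OF I J])
  have "A \<subseteq> J"
  proof
    fix a assume a: "a \<in> A"
    have "{s \<in> carrier R. s \<otimes> a \<in> A} = carrier R" using A.I_l_closed[OF a] by auto
    then show "a \<in> J" using carrier_in_system A.Icarr[OF a] by (simp add: J_def)
  qed
  moreover have "negligible R F (quotient_module (ideal_module R J) A)"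
    unfolding negligible_def
  proof
    fix m assume "m \<in> carrier (quotient_module (ideal_module R J) A)"
    then obtain x where x: "x \<in> J" "m = A +> x"
      unfolding quotient_module_simps ideal_module_simps by auto
    then have xc: "x \<in> carrier R" "{s \<in> carrier R. s \<otimes> x \<in> A} \<in> F"
      by (simp_all add: J_def)
    have "annihilator R (quotient_module (ideal_module R J) A) m
      = {s \<in> carrier R. s \<otimes> x \<in> A}"
      unfolding x(2)
      by (rule A.annihilator_coset) (simp_all add: ideal_module_simps xc)
    then show "annihilator R (quotient_module (ideal_module R J) A) m \<in> F"
      using xc(2) by simp
  qed
  ultimately have "A \<in> system_product R F F"
    unfolding system_product_def by (intro CollectI conjI A bexI[OF _ JF])
  then show ?thesis using idempotent unfolding idempotent_system_def by metis
qed

abbreviation T where "T \<equiv> torsion R F (self_module R)"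

lemma T_def: "T = {x \<in> carrier R. {r \<in> carrier R. r \<otimes> x = \<zero>} \<in> F}"
  by (simp add: torsion_def annihilator_def self_module_def scalars_via_simps)

lemma annihilator_ideal: "x \<in> carrier R \<Longrightarrow> ideal {r \<in> carrier R. r \<otimes> x = \<zero>} R"
  using colon_ideal[OF zeroideal] by simp

sublocale T: ideal T R
  using saturation_ideal[OF zeroideal] by (simp add: T_def)

lemma torsion_iff: "x \<in> T \<longleftrightarrow> x \<in> carrier R \<and> {r \<in> carrier R. r \<otimes> x = \<zero>} \<in> F"
  unfolding T_def by (rule mem_Collect_eq)

text \<open>The module \<open>R / F(R)\<close> has no torsion: for \<open>k\<close> in \<open>K\<close>, the annihilator of \<open>k x\<close> is the colon
  ideal of the annihilator of \<open>x\<close> and \<open>k\<close>, so the local criterion applies.\<close>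

lemma torsion_free:
  assumes K: "K \<in> F" and x: "x \<in> carrier R" and kx: "\<And>k. k \<in> K \<Longrightarrow> k \<otimes> x \<in> T"
  shows "x \<in> T"
proof -
  have "{r \<in> carrier R. r \<otimes> x = \<zero>} \<in> F"
  proof (rule system_local[OF annihilator_ideal[OF x] K])
    fix a assume a: "a \<in> K"
    have ac: "a \<in> carrier R" by (rule system_carrier[OF K a])
    have eq: "{s \<in> carrier R. s \<otimes> a \<in> {r \<in> carrier R. r \<otimes> x = \<zero>}}
      = {s \<in> carrier R. s \<otimes> (a \<otimes> x) = \<zero>}"
      by (rule Collect_cong) (simp add: x ac m_assoc cong: conj_cong)
    show "{s \<in> carrier R. s \<otimes> a \<in> {r \<in> carrier R. r \<otimes> x = \<zero>}} \<in> F"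
      unfolding eq by (rule conjunct2[OF kx[OF a, unfolded torsion_iff]])
  qed
  then show ?thesis unfolding torsion_iff using x by (rule conjI[rotated])
qed

lemma torsion_coset_iff: "x \<in> carrier R \<Longrightarrow> y \<in> carrier R \<Longrightarrow> T +> x = T +> y \<longleftrightarrow> x \<ominus> y \<in> T"
  using quotient_eq_iff_same_a_r_cos[OF T.is_ideal] by simp

lemma torsion_coset_smult:
  assumes "r \<in> carrier R" "x \<in> carrier R" "y \<in> carrier R" "T +> x = T +> y"
  shows "T +> (r \<otimes> x) = T +> (r \<otimes> y)"
  using T.union_cosets_smult[OF assms(1,2)] T.union_cosets_smult[OF assms(1,3)] assms(4) by simp

lemma torsion_coset_cancel:
  assumes K: "K \<in> F" and c: "x \<in> carrier R" "y \<in> carrier R"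
    and eq: "\<And>k. k \<in> K \<Longrightarrow> T +> (k \<otimes> x) = T +> (k \<otimes> y)"
  shows "T +> x = T +> y"
proof -
  have "k \<otimes> (x \<ominus> y) \<in> T" if k: "k \<in> K" for k
  proof -
    have kc: "k \<in> carrier R" by (rule system_carrier[OF K k])
    have "k \<otimes> x \<ominus> k \<otimes> y \<in> T" using eq[OF k] kc c by (simp add: torsion_coset_iff)
    then show ?thesis using kc c by (simp add: minus_eq r_distr r_minus)
  qed
  then have "x \<ominus> y \<in> T" by (rule torsion_free[OF K minus_closed[OF c]])
  then show ?thesis using c by (simp add: torsion_coset_iff)
qed

text \<open>A torsion element is killed by some \<open>r\<close> outside \<open>p\<close>, because its annihilator is in \<open>F\<close> and
  \<open>p\<close> is not.\<close>

lemma torsion_le_prime: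
  assumes p: "primeideal p R" and pF: "p \<notin> F"
  shows "T \<subseteq> p"
proof
  fix x assume x: "x \<in> T"
  have "{r \<in> carrier R. r \<otimes> x = \<zero>} \<in> F" by (rule conjunct2[OF x[unfolded torsion_iff]])
  then have "\<not> {r \<in> carrier R. r \<otimes> x = \<zero>} \<subseteq> p"
    using pF system_upward[OF _ primeideal.axioms(1)[OF p]] by metis
  then obtain r where r: "r \<in> carrier R" "r \<otimes> x = \<zero>" "r \<notin> p" by auto
  have "r \<otimes> x \<in> p"
    unfolding r(2)
    by (rule additive_subgroup.zero_closed[OF ideal.axioms(1)[OF primeideal.axioms(1)[OF p]]])
  then show "x \<in> p" using primeideal.I_prime[OF p r(1) T.Icarr[OF x]] r(3) by simp
qed


section \<open>Representatives of elements of the localization\<close>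

text \<open>This is linearity of a map from \<open>I\<close> to \<open>p / F(R)\<close>, for an ideal \<open>p\<close> containing \<open>F(R)\<close>, stated
  without operations on cosets: two cosets are equal as soon as they share a member, so it suffices
  that sums and multiples of members of the values are members of the values at sums and
  multiples.\<close>

definition partial_map :: "'a set \<Rightarrow> 'a set \<Rightarrow> ('a \<Rightarrow> 'a set) \<Rightarrow> bool"
  where "partial_map p I f \<longleftrightarrow> I \<in> F \<and> f \<in> extensional I \<and> (\<forall>a\<in>I. \<exists>x\<in>p. f a = T +> x) \<and>
    (\<forall>a\<in>I. \<forall>b\<in>I. \<forall>x\<in>f a. \<forall>y\<in>f b. x \<oplus> y \<in> f (a \<oplus> b)) \<and>
    (\<forall>r\<in>carrier R. \<forall>a\<in>I. \<forall>x\<in>f a. r \<otimes> x \<in> f (r \<otimes> a))"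

abbreviation endo where "endo \<equiv> partial_map (carrier R)"

lemma endo_system: "endo I f \<Longrightarrow> I \<in> F"
  unfolding partial_map_def by (rule conjunct1)

lemma endo_carrier: "endo I f \<Longrightarrow> a \<in> I \<Longrightarrow> a \<in> carrier R"
  by (rule system_carrier[OF endo_system])

lemma endo_nonempty:
  assumes "endo I f" "a \<in> I"
  obtains x where "x \<in> f a"
proof -
  obtain x where "x \<in> carrier R" "f a = T +> x"
    using assms unfolding partial_map_def by auto
  then show ?thesis using that T.self_mem_coset by auto
qed

lemma endo_coset:
  assumes "endo I f" "a \<in> I" "x \<in> f a"
  shows "x \<in> carrier R" "f a = T +> x"
proof -
  obtain z where z: "z \<in> carrier R" "f a = T +> z"
    using assms(1,2) unfolding partial_map_def by auto
  show "x \<in> carrier R" using T.mem_coset_iff[OF z(1)] z(2) assms(3) by auto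
  show "f a = T +> x" using T.a_repr_independence'[OF _ z(1)] z(2) assms(3) by auto
qed

lemma endo_mem_iff:
  assumes "endo I f" "a \<in> I" "x \<in> f a"
  shows "y \<in> f a \<longleftrightarrow> y \<in> carrier R \<and> y \<ominus> x \<in> T"
  using T.mem_coset_iff[OF endo_coset(1)[OF assms]] endo_coset(2)[OF assms] by simp

lemma endo_add: "endo I f \<Longrightarrow> a \<in> I \<Longrightarrow> b \<in> I \<Longrightarrow> x \<in> f a \<Longrightarrow> y \<in> f b \<Longrightarrow> x \<oplus> y \<in> f (a \<oplus> b)"
  unfolding partial_map_def by simp

lemma endo_smult: "endo I f \<Longrightarrow> r \<in> carrier R \<Longrightarrow> a \<in> I \<Longrightarrow> x \<in> f a \<Longrightarrow> r \<otimes> x \<in> f (r \<otimes> a)"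
  unfolding partial_map_def by simp

lemma endo_dom_add: "endo I f \<Longrightarrow> a \<in> I \<Longrightarrow> b \<in> I \<Longrightarrow> a \<oplus> b \<in> I"
  by (rule additive_subgroup.a_closed[OF ideal.axioms(1)[OF system_ideal[OF endo_system]]])

lemma endo_dom_smult: "endo I f \<Longrightarrow> r \<in> carrier R \<Longrightarrow> a \<in> I \<Longrightarrow> r \<otimes> a \<in> I"
  by (rule ideal.I_l_closed[OF system_ideal[OF endo_system]])

lemma endoI:
  assumes "I \<in> F" "f \<in> extensional I" "\<And>a. a \<in> I \<Longrightarrow> \<exists>x\<in>carrier R. f a = T +> x"
    and "\<And>a b x y. \<lbrakk>a \<in> I; b \<in> I; x \<in> f a; y \<in> f b\<rbrakk> \<Longrightarrow> x \<oplus> y \<in> f (a \<oplus> b)"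
    and "\<And>r a x. \<lbrakk>r \<in> carrier R; a \<in> I; x \<in> f a\<rbrakk> \<Longrightarrow> r \<otimes> x \<in> f (r \<otimes> a)"
  shows "endo I f"
  unfolding partial_map_def by (intro conjI ballI assms)

lemma partial_map_iff_endo:
  assumes "p \<subseteq> carrier R"
  shows "partial_map p I f \<longleftrightarrow> endo I f \<and> (\<forall>a\<in>I. \<exists>x\<in>p. x \<in> f a)"
proof
  assume pm: "partial_map p I f"
  have "\<forall>a\<in>I. \<exists>x\<in>carrier R. f a = T +> x"
    using pm assms unfolding partial_map_def by (meson subsetD)
  then have "endo I f"
    using pm unfolding partial_map_def by (elim conjE) (intro conjI)
  moreover have "\<exists>x\<in>p. x \<in> f a" if a: "a \<in> I" for a
  proof -
    obtain x where "x \<in> p" "f a = T +> x" using pm a unfolding partial_map_def by auto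
    then show ?thesis using T.self_mem_coset assms by auto
  qed
  ultimately show "endo I f \<and> (\<forall>a\<in>I. \<exists>x\<in>p. x \<in> f a)" by simp
next
  assume "endo I f \<and> (\<forall>a\<in>I. \<exists>x\<in>p. x \<in> f a)"
  then have e: "endo I f" and px: "\<And>a. a \<in> I \<Longrightarrow> \<exists>x\<in>p. x \<in> f a" by auto
  have "\<forall>a\<in>I. \<exists>x\<in>p. f a = T +> x"
    using endo_coset(2)[OF e] px by metis
  then show "partial_map p I f"
    using e unfolding partial_map_def by (elim conjE) (intro conjI)
qed

lemma partial_map_endo:
  assumes "ideal p R" "partial_map p I f"
  shows "endo I f"
  using assms(2)
    partial_map_iff_endo[OF additive_subgroup.a_subset[OF ideal.axioms(1)[OF assms(1)]]]
  by (rule conjunct1[OF iffD1, rotated])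

lemma torsion_ideal_module:
  assumes "ideal p R" "T \<subseteq> p"
  shows "torsion R F (ideal_module R p) = T"
proof (rule Set.set_eqI)
  fix x
  have "x \<in> torsion R F (ideal_module R p) \<longleftrightarrow> x \<in> p \<and> {r \<in> carrier R. r \<otimes> x = \<zero>} \<in> F"
    unfolding torsion_def annihilator_def ideal_module_simps by simp
  moreover have "x \<in> T \<Longrightarrow> x \<in> p" by (rule subsetD[OF assms(2)])
  moreover have "x \<in> p \<Longrightarrow> x \<in> carrier R" by (rule ideal.Icarr[OF assms(1)])
  ultimately show "x \<in> torsion R F (ideal_module R p) \<longleftrightarrow> x \<in> T"
    using torsion_iff[of x] by argo
qed

text \<open>When \<open>p\<close> contains \<open>F(R)\<close>, the torsion of \<open>p\<close> is that of \<open>R\<close>, and the cosets of \<open>p / F(p)\<close> are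
  literally cosets in \<open>R\<close>. Representatives for \<open>p\<close> are therefore particular representatives for
  \<open>R\<close>.\<close>

lemma loc_pairs_iff:
  assumes p: "ideal p R" "T \<subseteq> p"
  shows "(I, f) \<in> loc_pairs R F (ideal_module R p) \<longleftrightarrow> partial_map p I f"
proof -
  let ?Q = "torsion_quotient R F (ideal_module R p)"
  have pc: "x \<in> carrier R" if "x \<in> p" for x by (rule ideal.Icarr[OF p(1) that])
  have Q: "carrier ?Q = {T +> x | x. x \<in> p}" "add ?Q = set_add R"
    "\<And>r X. smult ?Q r X = (\<Union>x\<in>X. T +> (r \<otimes> x))"
    unfolding torsion_quotient_def torsion_ideal_module[OF p]
    by (simp_all add: quotient_module_simps ideal_module_simps)
  have *: "f (a \<oplus> b) = set_add R (f a) (f b) \<longleftrightarrow> (\<forall>x\<in>f a. \<forall>y\<in>f b. x \<oplus> y \<in> f (a \<oplus> b))"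
    if ab: "\<forall>a\<in>I. \<exists>x\<in>p. f a = T +> x" "a \<in> I" "b \<in> I" "a \<oplus> b \<in> I" for a b
  proof
    assume eq: "f (a \<oplus> b) = set_add R (f a) (f b)"
    show "\<forall>x\<in>f a. \<forall>y\<in>f b. x \<oplus> y \<in> f (a \<oplus> b)"
      unfolding eq set_add_def' by auto
  next
    assume h: "\<forall>x\<in>f a. \<forall>y\<in>f b. x \<oplus> y \<in> f (a \<oplus> b)"
    obtain x where x: "x \<in> p" "f a = T +> x" using ab by auto
    obtain y where y: "y \<in> p" "f b = T +> y" using ab by auto
    obtain z where z: "z \<in> p" "f (a \<oplus> b) = T +> z" using ab by auto
    have "x \<oplus> y \<in> T +> z"
      using h T.self_mem_coset[OF pc[OF x(1)]] T.self_mem_coset[OF pc[OF y(1)]] x(2) y(2) z(2) by auto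
    then have "T +> z = T +> (x \<oplus> y)" by (rule T.a_repr_independence'[OF _ pc[OF z(1)]])
    then show "f (a \<oplus> b) = set_add R (f a) (f b)"
      unfolding x(2) y(2) z(2) T.a_rcos_sum[OF pc[OF x(1)] pc[OF y(1)]] .
  qed
  have **: "f (r \<otimes> a) = (\<Union>x\<in>f a. T +> (r \<otimes> x)) \<longleftrightarrow> (\<forall>x\<in>f a. r \<otimes> x \<in> f (r \<otimes> a))"
    if ab: "\<forall>a\<in>I. \<exists>x\<in>p. f a = T +> x" "a \<in> I" "r \<in> carrier R" "r \<otimes> a \<in> I" for a r
  proof
    assume eq: "f (r \<otimes> a) = (\<Union>x\<in>f a. T +> (r \<otimes> x))"
    show "\<forall>x\<in>f a. r \<otimes> x \<in> f (r \<otimes> a)"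
    proof
      fix x assume x: "x \<in> f a"
      obtain x' where x': "x' \<in> p" "f a = T +> x'" using ab by auto
      have "x \<in> carrier R" using x T.mem_coset_iff[OF pc[OF x'(1)]] x'(2) by simp
      then have "r \<otimes> x \<in> T +> (r \<otimes> x)" using ab(3) by (intro T.self_mem_coset) simp
      then show "r \<otimes> x \<in> f (r \<otimes> a)" unfolding eq using x by (rule UN_I[rotated])
    qed
  next
    assume h: "\<forall>x\<in>f a. r \<otimes> x \<in> f (r \<otimes> a)"
    obtain x where x: "x \<in> p" "f a = T +> x" using ab by auto
    obtain z where z: "z \<in> p" "f (r \<otimes> a) = T +> z" using ab by auto
    have "r \<otimes> x \<in> T +> z"
      using h T.self_mem_coset[OF pc[OF x(1)]] x(2) z(2) by auto
    then have "T +> z = T +> (r \<otimes> x)" by (rule T.a_repr_independence'[OF _ pc[OF z(1)]])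
    then show "f (r \<otimes> a) = (\<Union>x\<in>f a. T +> (r \<otimes> x))"
      unfolding x(2) z(2) T.union_cosets_smult[OF ab(3) pc[OF x(1)]] .
  qed
  have PiE: "f \<in> I \<rightarrow>\<^sub>E {T +> x | x. x \<in> p} \<longleftrightarrow> f \<in> extensional I \<and> (\<forall>a\<in>I. \<exists>x\<in>p. f a = T +> x)"
    unfolding PiE_def Pi_def by auto
  have "(I, f) \<in> loc_pairs R F (ideal_module R p) \<longleftrightarrow>
      I \<in> F \<and> (f \<in> extensional I \<and> (\<forall>a\<in>I. \<exists>x\<in>p. f a = T +> x)) \<and>
      (\<forall>a\<in>I. \<forall>b\<in>I. f (a \<oplus> b) = set_add R (f a) (f b)) \<and>
      (\<forall>r\<in>carrier R. \<forall>a\<in>I. f (r \<otimes> a) = (\<Union>x\<in>f a. T +> (r \<otimes> x)))"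
    unfolding loc_pairs_def module_Hom_def ideal_module_simps Q mem_Sigma_iff mem_Collect_eq PiE ..
  also have "\<dots> \<longleftrightarrow> partial_map p I f"
  proof (cases "I \<in> F \<and> (\<forall>a\<in>I. \<exists>x\<in>p. f a = T +> x)")
    case False
    then show ?thesis unfolding partial_map_def by argo
  next
    case True
    then have IF: "I \<in> F" and D: "\<forall>a\<in>I. \<exists>x\<in>p. f a = T +> x" by (rule conjunct1, rule conjunct2)
    have cl: "a \<oplus> b \<in> I" if "a \<in> I" "b \<in> I" for a b
      by (rule additive_subgroup.a_closed[OF ideal.axioms(1)[OF system_ideal[OF IF]] that])
    have cl': "r \<otimes> a \<in> I" if "a \<in> I" "r \<in> carrier R" for r a
      by (rule ideal.I_l_closed[OF system_ideal[OF IF] that])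
    have "(\<forall>a\<in>I. \<forall>b\<in>I. f (a \<oplus> b) = set_add R (f a) (f b)) \<longleftrightarrow>
        (\<forall>a\<in>I. \<forall>b\<in>I. \<forall>x\<in>f a. \<forall>y\<in>f b. x \<oplus> y \<in> f (a \<oplus> b))"
      by (intro ball_cong refl * D cl)
    moreover have "(\<forall>r\<in>carrier R. \<forall>a\<in>I. f (r \<otimes> a) = (\<Union>x\<in>f a. T +> (r \<otimes> x))) \<longleftrightarrow>
        (\<forall>r\<in>carrier R. \<forall>a\<in>I. \<forall>x\<in>f a. r \<otimes> x \<in> f (r \<otimes> a))"
      by (intro ball_cong refl ** D cl')
    ultimately show ?thesis unfolding partial_map_def conj_assoc by (simp only:)
  qed
  finally show ?thesis .
qed

lemma loc_pairs_self: "(I, f) \<in> loc_pairs R F (self_module R) \<longleftrightarrow> endo I f"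
proof -
  have "T \<subseteq> carrier R" by (rule T.a_subset)
  from loc_pairs_iff[OF oneideal this] show ?thesis
    unfolding self_module_as_ideal_module .
qed

text \<open>Since \<open>R / F(R)\<close> is torsion-free, agreement on a member \<open>K\<close> of \<open>F\<close> spreads to \<open>a\<close>: the
  values at \<open>a\<close> become equal after multiplication by any \<open>k\<close> in \<open>K\<close>, because \<open>k a\<close> is in \<open>K\<close>.\<close>

lemma endo_agree:
  assumes f: "endo I f" and g: "endo J g" and K: "K \<in> F" "K \<subseteq> I \<inter> J"
    and fg: "\<And>a. a \<in> K \<Longrightarrow> f a = g a" and a: "a \<in> I \<inter> J"
  shows "f a = g a"
proof -
  have aI: "a \<in> I" and aJ: "a \<in> J" using a by auto
  have ac: "a \<in> carrier R" by (rule endo_carrier[OF f aI])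
  obtain x where x: "x \<in> f a" using endo_nonempty[OF f aI] .
  obtain y where y: "y \<in> g a" using endo_nonempty[OF g aJ] .
  have xc: "x \<in> carrier R" and yc: "y \<in> carrier R"
    using endo_coset(1)[OF f aI x] endo_coset(1)[OF g aJ y] .
  have "T +> x = T +> y"
  proof (rule torsion_coset_cancel[OF K(1) xc yc])
    fix k assume k: "k \<in> K"
    have kc: "k \<in> carrier R" by (rule system_carrier[OF K(1) k])
    have ka: "k \<otimes> a \<in> K" by (rule ideal.I_r_closed[OF system_ideal[OF K(1)] k ac])
    then have kaI: "k \<otimes> a \<in> I" using K(2) by auto
    have x': "k \<otimes> x \<in> f (k \<otimes> a)" by (rule endo_smult[OF f kc aI x])
    have y': "k \<otimes> y \<in> f (k \<otimes> a)" unfolding fg[OF ka] by (rule endo_smult[OF g kc aJ y])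
    show "T +> (k \<otimes> x) = T +> (k \<otimes> y)"
      using endo_coset(2)[OF f kaI x'] endo_coset(2)[OF f kaI y'] by simp
  qed
  then show ?thesis using endo_coset(2)[OF f aI x] endo_coset(2)[OF g aJ y] by simp
qed

lemma endo_restrict:
  assumes f: "endo I f" and J: "J \<in> F" "J \<subseteq> I"
  shows "endo J (restrict f J)"
proof (rule endoI[OF J(1)])
  have cl: "a \<oplus> b \<in> J" if "a \<in> J" "b \<in> J" for a b
    by (rule additive_subgroup.a_closed[OF ideal.axioms(1)[OF system_ideal[OF J(1)]] that])
  have cl': "r \<otimes> a \<in> J" if "a \<in> J" "r \<in> carrier R" for r a
    by (rule ideal.I_l_closed[OF system_ideal[OF J(1)] that])
  show "restrict f J \<in> extensional J" by simp
  show "\<exists>x\<in>carrier R. restrict f J a = T +> x" if "a \<in> J" for a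
  proof -
    have aI: "a \<in> I" using that J by auto
    obtain x where "x \<in> f a" using endo_nonempty[OF f aI] .
    then show ?thesis using endo_coset[OF f aI] that by auto
  qed
  show "x \<oplus> y \<in> restrict f J (a \<oplus> b)"
    if "a \<in> J" "b \<in> J" "x \<in> restrict f J a" "y \<in> restrict f J b" for a b x y
    using endo_add[OF f, of a b x y] that cl J(2) by auto
  show "r \<otimes> x \<in> restrict f J (r \<otimes> a)"
    if "r \<in> carrier R" "a \<in> J" "x \<in> restrict f J a" for r a x
    using endo_smult[OF f, of r a x] that cl' J(2) by auto
qed


section \<open>Classes of representatives\<close>

lemma loc_rel_iff:
  assumes p: "ideal p R" "T \<subseteq> p"
  shows "((I, f), (J, g)) \<in> loc_rel R F (ideal_module R p) \<longleftrightarrow>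
    partial_map p I f \<and> partial_map p J g \<and> (\<forall>a\<in>I \<inter> J. f a = g a)"
proof -
  have "(\<exists>K\<in>F. K \<subseteq> I \<inter> J \<and> restrict f K = restrict g K) \<longleftrightarrow> (\<forall>a\<in>I \<inter> J. f a = g a)"
    if fg: "partial_map p I f" "partial_map p J g"
  proof -
    have f: "endo I f" and g: "endo J g"
      by (rule partial_map_endo[OF p(1) fg(1)], rule partial_map_endo[OF p(1) fg(2)])
    have IJ: "I \<inter> J \<in> F" using endo_system[OF f] endo_system[OF g] by (rule system_Int)
    show ?thesis
    proof
      assume "\<exists>K\<in>F. K \<subseteq> I \<inter> J \<and> restrict f K = restrict g K"
      then obtain K where K: "K \<in> F" "K \<subseteq> I \<inter> J" "restrict f K = restrict g K" by auto
      have "f a = g a" if "a \<in> K" for a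
        using fun_cong[OF K(3), of a] that by simp
      then show "\<forall>a\<in>I \<inter> J. f a = g a" using endo_agree[OF f g K(1,2)] by simp
    next
      assume "\<forall>a\<in>I \<inter> J. f a = g a"
      then have "restrict f (I \<inter> J) = restrict g (I \<inter> J)" by (intro restrict_ext) simp
      then show "\<exists>K\<in>F. K \<subseteq> I \<inter> J \<and> restrict f K = restrict g K"
        by (intro bexI[OF _ IJ]) simp
    qed
  qed
  then show ?thesis
    unfolding loc_rel_def loc_pairs_iff[OF p] mem_Collect_eq prod.case by (simp cong: conj_cong)
qed

lemma loc_rel_equiv:
  assumes p: "ideal p R" "T \<subseteq> p"
  shows "equiv (loc_pairs R F (ideal_module R p)) (loc_rel R F (ideal_module R p))"
proof (rule equivI)
  note endo = partial_map_endo[OF p(1)]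
  show "loc_rel R F (ideal_module R p)
      \<subseteq> loc_pairs R F (ideal_module R p) \<times> loc_pairs R F (ideal_module R p)"
    unfolding loc_rel_def by auto
  show "refl_on (loc_pairs R F (ideal_module R p)) (loc_rel R F (ideal_module R p))"
  proof (rule refl_onI)
    fix u assume u: "u \<in> loc_pairs R F (ideal_module R p)"
    obtain I f where If: "u = (I, f)" by (metis surj_pair)
    show "(u, u) \<in> loc_rel R F (ideal_module R p)"
      using u unfolding If loc_rel_iff[OF p] loc_pairs_iff[OF p] by simp
  qed
  show "sym (loc_rel R F (ideal_module R p))"
  proof (rule symI)
    fix u v assume uv: "(u, v) \<in> loc_rel R F (ideal_module R p)"
    obtain I f J g where u: "u = (I, f)" and v: "v = (J, g)" by (metis surj_pair)
    note uv' = uv[unfolded u v loc_rel_iff[OF p]]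
    have "\<forall>a\<in>J \<inter> I. g a = f a" using conjunct2[OF conjunct2[OF uv']] by simp
    then show "(v, u) \<in> loc_rel R F (ideal_module R p)"
      unfolding u v loc_rel_iff[OF p]
      by (intro conjI conjunct1[OF uv'] conjunct1[OF conjunct2[OF uv']])
  qed
  show "trans (loc_rel R F (ideal_module R p))"
  proof (rule transI)
    fix u v w
    assume uv: "(u, v) \<in> loc_rel R F (ideal_module R p)"
      and vw: "(v, w) \<in> loc_rel R F (ideal_module R p)"
    obtain I f J g K h where u: "u = (I, f)" and v: "v = (J, g)" and w: "w = (K, h)"
      by (metis surj_pair)
    note uv' = uv[unfolded u v loc_rel_iff[OF p]] and vw' = vw[unfolded v w loc_rel_iff[OF p]]
    note f = conjunct1[OF uv'] and g = conjunct1[OF vw']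
      and h = conjunct1[OF conjunct2[OF vw']]
      and fg = conjunct2[OF conjunct2[OF uv']] and gh = conjunct2[OF conjunct2[OF vw']]
    have IJK: "(I \<inter> J) \<inter> K \<in> F"
      by (intro system_Int endo_system[OF endo[OF f]] endo_system[OF endo[OF g]]
          endo_system[OF endo[OF h]])
    have "f a = h a" if "a \<in> I \<inter> K" for a
    proof (rule endo_agree[OF endo[OF f] endo[OF h] IJK _ _ that])
      show "(I \<inter> J) \<inter> K \<subseteq> I \<inter> K" by auto
      show "f b = h b" if "b \<in> (I \<inter> J) \<inter> K" for b
        using bspec[OF fg, of b] bspec[OF gh, of b] that by simp
    qed
    then show "(u, w) \<in> loc_rel R F (ideal_module R p)"
      unfolding u w loc_rel_iff[OF p] by (intro conjI f h) simp
  qed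
qed

abbreviation S where "S \<equiv> loc_ring R F"
abbreviation cls where "cls \<equiv> loc_class R F (self_module R)"

lemma equiv_self: "equiv (loc_pairs R F (self_module R)) (loc_rel R F (self_module R))"
  unfolding self_module_as_ideal_module by (rule loc_rel_equiv[OF oneideal T.a_subset])

lemma carrier_S: "carrier S = loc_pairs R F (self_module R) // loc_rel R F (self_module R)"
  by (simp add: loc_ring_def loc_module_def)

lemma cls_closed: "endo I f \<Longrightarrow> cls I f \<in> carrier S"
  unfolding carrier_S loc_class_def by (rule quotientI) (simp add: loc_pairs_self)

lemma cls_self: "endo I f \<Longrightarrow> (I, f) \<in> cls I f"
  unfolding loc_class_def by (rule equiv_class_self[OF equiv_self]) (simp add: loc_pairs_self)

lemma carrier_memD:
  assumes "X \<in> carrier S" "(I, f) \<in> X"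
  shows "endo I f" "X = cls I f"
proof -
  obtain u where u: "u \<in> loc_pairs R F (self_module R)" "X = loc_rel R F (self_module R) `` {u}"
    using assms(1) unfolding carrier_S by (rule quotientE)
  have r: "(u, (I, f)) \<in> loc_rel R F (self_module R)" using assms(2) u(2) by simp
  then show "X = cls I f"
    unfolding loc_class_def u(2) by (rule equiv_class_eq[OF equiv_self])
  show "endo I f"
    using r unfolding loc_rel_def by (auto simp: loc_pairs_self)
qed

lemma carrier_rep:
  assumes "X \<in> carrier S"
  obtains I f where "endo I f" "(I, f) \<in> X" "X = cls I f"
proof -
  obtain u where u: "u \<in> loc_pairs R F (self_module R)" "X = loc_rel R F (self_module R) `` {u}"
    using assms(1) unfolding carrier_S by (rule quotientE)
  have "u \<in> X" unfolding u(2) by (rule equiv_class_self[OF equiv_self u(1)])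
  then have m: "(fst u, snd u) \<in> X" by simp
  from that[OF carrier_memD(1)[OF assms m] m carrier_memD(2)[OF assms m]] show ?thesis .
qed

lemma cls_eqI:
  assumes "endo I f" "endo J g" "K \<in> F" "K \<subseteq> I \<inter> J" "\<And>a. a \<in> K \<Longrightarrow> f a = g a"
  shows "cls I f = cls J g"
proof -
  have "\<forall>a\<in>I \<inter> J. f a = g a" using endo_agree[OF assms] by simp
  then have "((I, f), (J, g)) \<in> loc_rel R F (self_module R)"
    using loc_rel_iff[OF oneideal T.a_subset] assms(1,2)
    unfolding self_module_as_ideal_module by simp
  then show ?thesis unfolding loc_class_def by (rule equiv_class_eq[OF equiv_self])
qed

lemma cls_eqD:
  assumes "X \<in> carrier S" "(I, f) \<in> X" "(J, g) \<in> X" "a \<in> I" "a \<in> J"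
  shows "f a = g a"
proof -
  have "(J, g) \<in> cls I f" using carrier_memD(2)[OF assms(1,2)] assms(3) by simp
  then have "((I, f), (J, g)) \<in> loc_rel R F (self_module R)" unfolding loc_class_def by simp
  then show ?thesis
    using loc_rel_iff[OF oneideal T.a_subset] assms(4,5)
    unfolding self_module_as_ideal_module by simp
qed

text \<open>A pair \<open>(a, x)\<close> of the graph expresses the equation \<open>a X = x\<close> in the localized ring. The
  union over all representatives avoids a choice of domain.\<close>

definition graph :: "('a set \<times> ('a \<Rightarrow> 'a set)) set \<Rightarrow> ('a \<times> 'a) set"
  where "graph X = {(a, x). \<exists>I f. (I, f) \<in> X \<and> a \<in> I \<and> x \<in> f a}"

lemma graphI: "(I, f) \<in> X \<Longrightarrow> a \<in> I \<Longrightarrow> x \<in> f a \<Longrightarrow> (a, x) \<in> graph X"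
  unfolding graph_def by auto

lemma graphE:
  assumes "(a, x) \<in> graph X"
  obtains I f where "(I, f) \<in> X" "a \<in> I" "x \<in> f a"
  using assms unfolding graph_def by auto

lemma graph_carrier:
  assumes "X \<in> carrier S" "(a, x) \<in> graph X"
  shows "a \<in> carrier R" "x \<in> carrier R"
proof -
  obtain I f where If: "(I, f) \<in> X" "a \<in> I" "x \<in> f a" using graphE[OF assms(2)] .
  have f: "endo I f" by (rule carrier_memD(1)[OF assms(1) If(1)])
  show "a \<in> carrier R" "x \<in> carrier R" by (rule endo_carrier[OF f If(2)], rule endo_coset(1)[OF f If(2,3)])
qed

lemma graph_unique:
  assumes X: "X \<in> carrier S" and x: "(a, x) \<in> graph X" and y: "(a, y) \<in> graph X"
  shows "x \<ominus> y \<in> T"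
proof -
  obtain I f where If: "(I, f) \<in> X" "a \<in> I" "x \<in> f a" using graphE[OF x] .
  obtain J g where Jg: "(J, g) \<in> X" "a \<in> J" "y \<in> g a" using graphE[OF y] .
  have "x \<in> g a" using cls_eqD[OF X If(1) Jg(1) If(2) Jg(2)] If(3) by simp
  then show ?thesis using endo_mem_iff[OF carrier_memD(1)[OF X Jg(1)] Jg(2,3)] by simp
qed

lemma graph_smult:
  assumes X: "X \<in> carrier S" and x: "(a, x) \<in> graph X" and r: "r \<in> carrier R"
  shows "(r \<otimes> a, r \<otimes> x) \<in> graph X"
proof -
  obtain I f where If: "(I, f) \<in> X" "a \<in> I" "x \<in> f a" using graphE[OF x] .
  have f: "endo I f" by (rule carrier_memD(1)[OF X If(1)])
  show ?thesis
    by (rule graphI[OF If(1) endo_dom_smult[OF f r If(2)] endo_smult[OF f r If(2,3)]])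
qed

lemma graph_domain:
  assumes X: "X \<in> carrier S"
  obtains I where "I \<in> F" "\<forall>a\<in>I. \<exists>x. (a, x) \<in> graph X"
proof -
  obtain I f where f: "endo I f" "(I, f) \<in> X" using carrier_rep[OF X] .
  have "\<exists>x. (a, x) \<in> graph X" if a: "a \<in> I" for a
  proof -
    obtain x where "x \<in> f a" using endo_nonempty[OF f(1) a] .
    then show ?thesis using graphI[OF f(2) a] by auto
  qed
  then show ?thesis by (intro that[OF endo_system[OF f(1)]] ballI)
qed

text \<open>Extensionality: this turns every identity in the localized ring into the task of finding, for
  each \<open>a\<close> in some member of \<open>F\<close>, one common value of both sides at \<open>a\<close>.\<close>

lemma graph_eqI:
  assumes X: "X \<in> carrier S" and Y: "Y \<in> carrier S" and K: "K \<in> F"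
    and XY: "\<And>a. a \<in> K \<Longrightarrow> \<exists>x. (a, x) \<in> graph X \<and> (a, x) \<in> graph Y"
  shows "X = Y"
proof -
  obtain I f where f: "endo I f" "(I, f) \<in> X" "X = cls I f" using carrier_rep[OF X] .
  obtain J g where g: "endo J g" "(J, g) \<in> Y" "Y = cls J g" using carrier_rep[OF Y] .
  have D: "(K \<inter> I) \<inter> J \<in> F"
    using K endo_system[OF f(1)] endo_system[OF g(1)] by (intro system_Int)
  have "f a = g a" if a: "a \<in> (K \<inter> I) \<inter> J" for a
  proof -
    have aI: "a \<in> I" and aJ: "a \<in> J" and "a \<in> K" using a by auto
    obtain x where x: "(a, x) \<in> graph X" "(a, x) \<in> graph Y" using XY[OF \<open>a \<in> K\<close>] by auto
    obtain I' f' where f': "(I', f') \<in> X" "a \<in> I'" "x \<in> f' a" using graphE[OF x(1)] .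
    obtain J' g' where g': "(J', g') \<in> Y" "a \<in> J'" "x \<in> g' a" using graphE[OF x(2)] .
    have "x \<in> f a" using cls_eqD[OF X f(2) f'(1) aI f'(2)] f'(3) by simp
    then have "f a = T +> x" by (rule endo_coset(2)[OF f(1) aI])
    moreover have "x \<in> g a" using cls_eqD[OF Y g(2) g'(1) aJ g'(2)] g'(3) by simp
    then have "g a = T +> x" by (rule endo_coset(2)[OF g(1) aJ])
    ultimately show ?thesis by simp
  qed
  then have "cls I f = cls J g" by (intro cls_eqI[OF f(1) g(1) D]) auto
  then show ?thesis using f(3) g(3) by simp
qed

lemma graph_coset:
  assumes X: "X \<in> carrier S" and x: "(a, x) \<in> graph X" and y: "(a, y) \<in> graph X"
  shows "T +> x = T +> y"
  using graph_unique[OF X x y] graph_carrier(2)[OF X x] graph_carrier(2)[OF X y]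
  by (simp add: torsion_coset_iff)

lemma graph_shift:
  assumes X: "X \<in> carrier S" and x: "(a, x) \<in> graph X" and y: "y \<in> carrier R" "T +> y = T +> x"
  shows "(a, y) \<in> graph X"
proof -
  obtain I f where If: "(I, f) \<in> X" "a \<in> I" "x \<in> f a" using graphE[OF x] .
  have "f a = T +> y" using endo_coset(2)[OF carrier_memD(1)[OF X If(1)] If(2,3)] y(2) by simp
  then have "y \<in> f a" using T.self_mem_coset[OF y(1)] by simp
  then show ?thesis by (rule graphI[OF If(1,2)])
qed


section \<open>Addition and multiplication on graphs\<close>

text \<open>Operations on classes are unions over representatives. Once all representatives give the same
  class, the union is that class.\<close>

lemma union_of_equal_classes:
  assumes "(I, f) \<in> X" "(J, g) \<in> Y"
    and "\<And>I' f' J' g'. (I', f') \<in> X \<Longrightarrow> (J', g') \<in> Y \<Longrightarrow> h I' f' J' g' = h I f J g"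
  shows "(\<Union>(I, f)\<in>X. \<Union>(J, g)\<in>Y. h I f J g) = h I f J g"
proof
  show "(\<Union>(I, f)\<in>X. \<Union>(J, g)\<in>Y. h I f J g) \<subseteq> h I f J g"
    using assms(3) by auto
  show "h I f J g \<subseteq> (\<Union>(I, f)\<in>X. \<Union>(J, g)\<in>Y. h I f J g)"
    using assms(1,2) by auto
qed

lemma endo_sum:
  assumes f: "endo I f" and g: "endo J g"
  shows "endo (I \<inter> J) (\<lambda>a\<in>I \<inter> J. set_add R (f a) (g a))" (is "endo _ ?h")
proof (rule endoI)
  show "I \<inter> J \<in> F" by (rule system_Int[OF endo_system[OF f] endo_system[OF g]])
  show "?h \<in> extensional (I \<inter> J)" by simp
  show "\<exists>x\<in>carrier R. ?h a = T +> x" if "a \<in> I \<inter> J" for a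
  proof -
    have aI: "a \<in> I" and aJ: "a \<in> J" using that by auto
    obtain x where x: "x \<in> f a" using endo_nonempty[OF f aI] .
    obtain y where y: "y \<in> g a" using endo_nonempty[OF g aJ] .
    have "?h a = T +> (x \<oplus> y)"
      using that endo_coset(2)[OF f aI x] endo_coset(2)[OF g aJ y]
        T.a_rcos_sum[OF endo_coset(1)[OF f aI x] endo_coset(1)[OF g aJ y]] by simp
    then show ?thesis using endo_coset(1)[OF f aI x] endo_coset(1)[OF g aJ y] by auto
  qed
next
  fix a b z w assume ab: "a \<in> I \<inter> J" "b \<in> I \<inter> J" and z: "z \<in> ?h a" and w: "w \<in> ?h b"
  have abI: "a \<in> I" "b \<in> I" "a \<in> J" "b \<in> J" using ab by auto
  obtain x y where xy: "x \<in> f a" "y \<in> g a" "z = x \<oplus> y"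
    using z ab(1) unfolding set_add_def' by auto
  obtain x' y' where xy': "x' \<in> f b" "y' \<in> g b" "w = x' \<oplus> y'"
    using w ab(2) unfolding set_add_def' by auto
  have c: "x \<in> carrier R" "y \<in> carrier R" "x' \<in> carrier R" "y' \<in> carrier R"
    by (rule endo_coset(1)[OF f abI(1) xy(1)], rule endo_coset(1)[OF g abI(3) xy(2)],
        rule endo_coset(1)[OF f abI(2) xy'(1)], rule endo_coset(1)[OF g abI(4) xy'(2)])
  have "z \<oplus> w = (x \<oplus> x') \<oplus> (y \<oplus> y')" unfolding xy(3) xy'(3) using c by (simp add: a_ac)
  moreover have "x \<oplus> x' \<in> f (a \<oplus> b)" by (rule endo_add[OF f abI(1,2) xy(1) xy'(1)])
  moreover have "y \<oplus> y' \<in> g (a \<oplus> b)" by (rule endo_add[OF g abI(3,4) xy(2) xy'(2)])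
  moreover have "a \<oplus> b \<in> I \<inter> J"
    using endo_dom_add[OF f abI(1,2)] endo_dom_add[OF g abI(3,4)] by simp
  ultimately show "z \<oplus> w \<in> ?h (a \<oplus> b)" unfolding set_add_def' by auto
next
  fix r a z assume r: "r \<in> carrier R" and a: "a \<in> I \<inter> J" and z: "z \<in> ?h a"
  have aI: "a \<in> I" "a \<in> J" using a by auto
  obtain x y where xy: "x \<in> f a" "y \<in> g a" "z = x \<oplus> y"
    using z a unfolding set_add_def' by auto
  have "r \<otimes> z = r \<otimes> x \<oplus> r \<otimes> y"
    unfolding xy(3) by (rule r_distr[OF endo_coset(1)[OF f aI(1) xy(1)] endo_coset(1)[OF g aI(2) xy(2)] r])
  moreover have "r \<otimes> x \<in> f (r \<otimes> a)" by (rule endo_smult[OF f r aI(1) xy(1)])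
  moreover have "r \<otimes> y \<in> g (r \<otimes> a)" by (rule endo_smult[OF g r aI(2) xy(2)])
  moreover have "r \<otimes> a \<in> I \<inter> J"
    using endo_dom_smult[OF f r aI(1)] endo_dom_smult[OF g r aI(2)] by simp
  ultimately show "r \<otimes> z \<in> ?h (r \<otimes> a)" unfolding set_add_def' by auto
qed

lemma S_add_def:
  "X \<oplus>\<^bsub>S\<^esub> Y = (\<Union>(I, f)\<in>X. \<Union>(J, g)\<in>Y. cls (I \<inter> J) (\<lambda>a\<in>I \<inter> J. set_add R (f a) (g a)))"
  unfolding loc_ring_def loc_module_def torsion_quotient_def self_module_as_ideal_module
  by (simp add: quotient_module_simps ideal_module_simps)

lemma S_add_eq:
  assumes X: "X \<in> carrier S" and Y: "Y \<in> carrier S" and f: "(I, f) \<in> X" and g: "(J, g) \<in> Y"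
  shows "X \<oplus>\<^bsub>S\<^esub> Y = cls (I \<inter> J) (\<lambda>a\<in>I \<inter> J. set_add R (f a) (g a))"
  unfolding S_add_def
proof (rule union_of_equal_classes[OF f g])
  fix I' f' J' g' assume f': "(I', f') \<in> X" and g': "(J', g') \<in> Y"
  note ef = carrier_memD(1)[OF X f] and eg = carrier_memD(1)[OF Y g]
    and ef' = carrier_memD(1)[OF X f'] and eg' = carrier_memD(1)[OF Y g']
  show "cls (I' \<inter> J') (\<lambda>a\<in>I' \<inter> J'. set_add R (f' a) (g' a)) =
      cls (I \<inter> J) (\<lambda>a\<in>I \<inter> J. set_add R (f a) (g a))"
  proof (rule cls_eqI[OF endo_sum[OF ef' eg'] endo_sum[OF ef eg]])
    show "(I' \<inter> J') \<inter> (I \<inter> J) \<in> F"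
      by (intro system_Int endo_system[OF ef] endo_system[OF ef'] endo_system[OF eg] endo_system[OF eg'])
    fix a assume a: "a \<in> (I' \<inter> J') \<inter> (I \<inter> J)"
    have "f' a = f a" using a by (intro cls_eqD[OF X f' f]) auto
    moreover have "g' a = g a" using a by (intro cls_eqD[OF Y g' g]) auto
    ultimately show "(\<lambda>a\<in>I' \<inter> J'. set_add R (f' a) (g' a)) a = (\<lambda>a\<in>I \<inter> J. set_add R (f a) (g a)) a"
      using a by simp
  qed simp
qed

lemma S_add_closed:
  assumes X: "X \<in> carrier S" and Y: "Y \<in> carrier S"
  shows "X \<oplus>\<^bsub>S\<^esub> Y \<in> carrier S"
proof -
  obtain I f where f: "endo I f" "(I, f) \<in> X" using carrier_rep[OF X] .
  obtain J g where g: "endo J g" "(J, g) \<in> Y" using carrier_rep[OF Y] .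
  show ?thesis unfolding S_add_eq[OF X Y f(2) g(2)] by (rule cls_closed[OF endo_sum[OF f(1) g(1)]])
qed

lemma graph_add:
  assumes X: "X \<in> carrier S" and Y: "Y \<in> carrier S"
    and x: "(a, x) \<in> graph X" and y: "(a, y) \<in> graph Y"
  shows "(a, x \<oplus> y) \<in> graph (X \<oplus>\<^bsub>S\<^esub> Y)"
proof -
  obtain I f where f: "(I, f) \<in> X" "a \<in> I" "x \<in> f a" using graphE[OF x] .
  obtain J g where g: "(J, g) \<in> Y" "a \<in> J" "y \<in> g a" using graphE[OF y] .
  show ?thesis
    unfolding S_add_eq[OF X Y f(1) g(1)]
  proof (rule graphI[OF cls_self[OF endo_sum[OF carrier_memD(1)[OF X f(1)] carrier_memD(1)[OF Y g(1)]]]])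
    show "a \<in> I \<inter> J" using f(2) g(2) by simp
    then show "x \<oplus> y \<in> (\<lambda>a\<in>I \<inter> J. set_add R (f a) (g a)) a"
      using f(3) g(3) unfolding set_add_def' by auto
  qed
qed

lemma preimage_iff:
  assumes f: "endo I f" and J: "J \<in> F"
  shows "a \<in> ideal_preimage R F I f J \<longleftrightarrow> a \<in> I \<and> (\<exists>b\<in>J. b \<in> f a)"
proof -
  have "f a \<in> ideal_image R F J \<longleftrightarrow> (\<exists>b\<in>J. b \<in> f a)" if a: "a \<in> I"
  proof
    assume "f a \<in> ideal_image R F J"
    then obtain b where b: "b \<in> J" "f a = T +> b" unfolding ideal_image_def by auto
    then show "\<exists>b\<in>J. b \<in> f a" using T.self_mem_coset[OF system_carrier[OF J b(1)]] by auto
  next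
    assume "\<exists>b\<in>J. b \<in> f a"
    then obtain b where b: "b \<in> J" "b \<in> f a" by auto
    show "f a \<in> ideal_image R F J"
      unfolding ideal_image_def using endo_coset(2)[OF f a b(2)] b(1) by (rule image_eqI)
  qed
  then show ?thesis unfolding ideal_preimage_def by auto
qed

text \<open>For \<open>a\<close> in the domain of \<open>f\<close>, the ideal \<open>J\<close> is contained in the colon ideal of the preimage
  and \<open>a\<close>, so the preimage lies in \<open>F\<close> by the local criterion.\<close>

lemma preimage_in_system:
  assumes f: "endo I f" and J: "J \<in> F"
  shows "ideal_preimage R F I f J \<in> F" (is "?K \<in> F")
proof (rule system_local[OF _ endo_system[OF f]])
  interpret J: ideal J R by (rule system_ideal[OF J])
  note mem = preimage_iff[OF f J]
  show K: "ideal ?K R"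
  proof (rule ideal_from_closure)
    show "?K \<subseteq> carrier R" using endo_carrier[OF f] mem by auto
    obtain x where x: "x \<in> f \<zero>" using endo_nonempty[OF f system_zero[OF endo_system[OF f]]] .
    have "\<zero> \<otimes> x \<in> f (\<zero> \<otimes> \<zero>)"
      by (rule endo_smult[OF f zero_closed system_zero[OF endo_system[OF f]] x])
    then have "\<zero> \<in> f \<zero>"
      using endo_coset(1)[OF f system_zero[OF endo_system[OF f]] x] by simp
    then show "\<zero> \<in> ?K" unfolding mem using system_zero[OF endo_system[OF f]] J.zero_closed by auto
  next
    fix a b assume "a \<in> ?K" "b \<in> ?K"
    then obtain x y where ab: "a \<in> I" "b \<in> I" and x: "x \<in> J" "x \<in> f a" and y: "y \<in> J" "y \<in> f b"
      unfolding mem by auto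
    show "a \<oplus> b \<in> ?K"
      unfolding mem
      by (intro conjI bexI[of _ "x \<oplus> y"] endo_dom_add[OF f ab] endo_add[OF f ab x(2) y(2)]
          J.a_closed[OF x(1) y(1)])
  next
    fix r a assume r: "r \<in> carrier R" and "a \<in> ?K"
    then obtain x where a: "a \<in> I" and x: "x \<in> J" "x \<in> f a" unfolding mem by auto
    show "r \<otimes> a \<in> ?K"
      unfolding mem
      by (intro conjI bexI[of _ "r \<otimes> x"] endo_dom_smult[OF f r a] endo_smult[OF f r a x(2)]
          J.I_l_closed[OF x(1) r])
  qed
  fix a assume a: "a \<in> I"
  obtain x where x: "x \<in> f a" using endo_nonempty[OF f a] .
  have "J \<subseteq> {s \<in> carrier R. s \<otimes> a \<in> ?K}"
  proof
    fix s assume s: "s \<in> J"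
    have sc: "s \<in> carrier R" by (rule system_carrier[OF J s])
    have "s \<otimes> a \<in> ?K"
      unfolding mem
      by (intro conjI bexI[of _ "s \<otimes> x"] endo_dom_smult[OF f sc a] endo_smult[OF f sc a x]
          J.I_r_closed[OF s endo_coset(1)[OF f a x]])
    then show "s \<in> {s \<in> carrier R. s \<otimes> a \<in> ?K}" using sc by simp
  qed
  then show "{s \<in> carrier R. s \<otimes> a \<in> ?K} \<in> F"
    by (rule system_upward[OF J colon_ideal[OF K endo_carrier[OF f a]]])
qed

text \<open>A linear map into the torsion-free module \<open>R / F(R)\<close> kills the torsion elements of its
  domain, so it has equal values at elements that are congruent modulo \<open>F(R)\<close>.\<close>

lemma endo_congruent:
  assumes g: "endo J g" and b: "b \<in> J" "b' \<in> J" "T +> b = T +> b'"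
  shows "g b = g b'"
proof -
  obtain y where y: "y \<in> g b" using endo_nonempty[OF g b(1)] .
  obtain y' where y': "y' \<in> g b'" using endo_nonempty[OF g b(2)] .
  have c: "b \<in> carrier R" "b' \<in> carrier R" "y \<in> carrier R" "y' \<in> carrier R"
    by (rule endo_carrier[OF g b(1)], rule endo_carrier[OF g b(2)],
        rule endo_coset(1)[OF g b(1) y], rule endo_coset(1)[OF g b(2) y'])
  have "b \<ominus> b' \<in> T" using b(3) torsion_coset_iff[OF c(1,2)] by simp
  then have K: "{r \<in> carrier R. r \<otimes> (b \<ominus> b') = \<zero>} \<in> F" unfolding torsion_iff by (rule conjunct2)
  have "T +> y = T +> y'"
  proof (rule torsion_coset_cancel[OF K c(3,4)])
    fix k assume "k \<in> {r \<in> carrier R. r \<otimes> (b \<ominus> b') = \<zero>}"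
    then have k: "k \<in> carrier R" and "k \<otimes> (b \<ominus> b') = \<zero>" by auto
    then have "k \<otimes> b \<oplus> \<ominus> (k \<otimes> b') = \<zero>" using c by (simp add: minus_eq r_distr r_minus)
    then have "\<ominus> (\<ominus> (k \<otimes> b')) = k \<otimes> b" using k c by (intro minus_equality) simp_all
    then have eq: "k \<otimes> b = k \<otimes> b'" using k c by simp
    have m: "k \<otimes> y \<in> g (k \<otimes> b)" by (rule endo_smult[OF g k b(1) y])
    have m': "k \<otimes> y' \<in> g (k \<otimes> b)" unfolding eq by (rule endo_smult[OF g k b(2) y'])
    show "T +> (k \<otimes> y) = T +> (k \<otimes> y')"
      using endo_coset(2)[OF g endo_dom_smult[OF g k b(1)] m]
        endo_coset(2)[OF g endo_dom_smult[OF g k b(1)] m'] by simp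
  qed
  then show ?thesis using endo_coset(2)[OF g b(1) y] endo_coset(2)[OF g b(2) y'] by simp
qed

lemma descended_map_eq:
  assumes f: "endo I f" and g: "endo J g" and a: "a \<in> I" and b: "b \<in> f a" "b \<in> J"
  shows "descended_map J g (f a) = g b"
proof -
  have const: "g b' = g b" if "b' \<in> f a" "b' \<in> J" for b'
    using endo_coset(2)[OF f a that(1)] endo_coset(2)[OF f a b(1)]
    by (intro endo_congruent[OF g that(2) b(2)]) simp
  show ?thesis
    unfolding descended_map_def
  proof (rule SUP_eq_const)
    show "f a \<inter> J \<noteq> {}" using b by auto
    show "g b' = g b" if "b' \<in> f a \<inter> J" for b'
      by (rule const[OF IntD1[OF that] IntD2[OF that]])
  qed
qed

lemma endo_comp:
  assumes f: "endo I f" and g: "endo J g"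
  shows "endo (ideal_preimage R F I f J)
    (\<lambda>a\<in>ideal_preimage R F I f J. descended_map J g (f a))" (is "endo ?K ?h")
proof -
  have KF: "?K \<in> F" by (rule preimage_in_system[OF f endo_system[OF g]])
  interpret K: ideal ?K R by (rule system_ideal[OF KF])
  note mem = preimage_iff[OF f endo_system[OF g]]
  show ?thesis
  proof (rule endoI[OF KF])
    show "?h \<in> extensional ?K" by simp
    show "\<exists>x\<in>carrier R. ?h a = T +> x" if a: "a \<in> ?K" for a
    proof -
      obtain b where b: "a \<in> I" "b \<in> J" "b \<in> f a" using a unfolding mem by auto
      obtain y where y: "y \<in> g b" using endo_nonempty[OF g b(2)] .
      have "?h a = T +> y"
        using a descended_map_eq[OF f g b(1,3,2)] endo_coset(2)[OF g b(2) y] by simp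
      then show ?thesis using endo_coset(1)[OF g b(2) y] by auto
    qed
  next
    fix a a' x x' assume a: "a \<in> ?K" "a' \<in> ?K" and x: "x \<in> ?h a" "x' \<in> ?h a'"
    obtain b where b: "a \<in> I" "b \<in> J" "b \<in> f a" using a(1) unfolding mem by auto
    obtain b' where b': "a' \<in> I" "b' \<in> J" "b' \<in> f a'" using a(2) unfolding mem by auto
    have xg: "x \<in> g b" "x' \<in> g b'"
      using x a descended_map_eq[OF f g b(1,3,2)] descended_map_eq[OF f g b'(1,3,2)] by simp_all
    have "?h (a \<oplus> a') = g (b \<oplus> b')"
      using K.a_closed[OF a] descended_map_eq[OF f g endo_dom_add[OF f b(1) b'(1)]
          endo_add[OF f b(1) b'(1) b(3) b'(3)] endo_dom_add[OF g b(2) b'(2)]] by simp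
    then show "x \<oplus> x' \<in> ?h (a \<oplus> a')" using endo_add[OF g b(2) b'(2) xg] by simp
  next
    fix r a x assume r: "r \<in> carrier R" and a: "a \<in> ?K" and x: "x \<in> ?h a"
    obtain b where b: "a \<in> I" "b \<in> J" "b \<in> f a" using a unfolding mem by auto
    have xg: "x \<in> g b" using x a descended_map_eq[OF f g b(1,3,2)] by simp
    have "?h (r \<otimes> a) = g (r \<otimes> b)"
      using K.I_l_closed[OF a r] descended_map_eq[OF f g endo_dom_smult[OF f r b(1)]
          endo_smult[OF f r b(1,3)] endo_dom_smult[OF g r b(2)]] by simp
    then show "r \<otimes> x \<in> ?h (r \<otimes> a)" using endo_smult[OF g r b(2) xg] by simp
  qed
qed

lemma S_mult_def:
  "X \<otimes>\<^bsub>S\<^esub> Y = (\<Union>(I, f)\<in>X. \<Union>(J, g)\<in>Y. cls (ideal_preimage R F I f J)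
    (\<lambda>a\<in>ideal_preimage R F I f J. descended_map J g (f a)))"
  unfolding loc_ring_def by simp

lemma S_mult_eq:
  assumes X: "X \<in> carrier S" and Y: "Y \<in> carrier S" and f: "(I, f) \<in> X" and g: "(J, g) \<in> Y"
  shows "X \<otimes>\<^bsub>S\<^esub> Y = cls (ideal_preimage R F I f J)
    (\<lambda>a\<in>ideal_preimage R F I f J. descended_map J g (f a))"
  unfolding S_mult_def
proof (rule union_of_equal_classes[OF f g])
  fix I' f' J' g' assume f': "(I', f') \<in> X" and g': "(J', g') \<in> Y"
  note ef = carrier_memD(1)[OF X f] and eg = carrier_memD(1)[OF Y g]
    and ef' = carrier_memD(1)[OF X f'] and eg' = carrier_memD(1)[OF Y g']
  note mem = preimage_iff[OF ef endo_system[OF eg]]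
    and mem' = preimage_iff[OF ef' endo_system[OF eg']]
  have JJ: "J \<inter> J' \<in> F" by (rule system_Int[OF endo_system[OF eg] endo_system[OF eg']])
  \<comment> \<open>The smaller domain on which a single element of \<open>J \<inter> J'\<close> represents both \<open>f a\<close> and \<open>f' a\<close>.\<close>
  let ?D = "ideal_preimage R F I f (J \<inter> J') \<inter> I'"
  have D: "\<exists>b. a \<in> I \<and> a \<in> I' \<and> b \<in> J \<and> b \<in> J' \<and> b \<in> f a \<and> b \<in> f' a" if a: "a \<in> ?D" for a
  proof -
    obtain b where b: "a \<in> I" "b \<in> J" "b \<in> J'" "b \<in> f a"
      using a unfolding preimage_iff[OF ef JJ] Int_iff by auto
    have "f' a = f a" using a b(1) by (intro cls_eqD[OF X f' f]) auto
    then show ?thesis using b a by auto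
  qed
  show "cls (ideal_preimage R F I' f' J')
        (\<lambda>a\<in>ideal_preimage R F I' f' J'. descended_map J' g' (f' a)) =
      cls (ideal_preimage R F I f J) (\<lambda>a\<in>ideal_preimage R F I f J. descended_map J g (f a))"
  proof (rule cls_eqI[OF endo_comp[OF ef' eg'] endo_comp[OF ef eg]])
    show "?D \<in> F" by (rule system_Int[OF preimage_in_system[OF ef JJ] endo_system[OF ef']])
    show sub: "?D \<subseteq> ideal_preimage R F I' f' J' \<inter> ideal_preimage R F I f J"
    proof
      fix a assume "a \<in> ?D"
      then show "a \<in> ideal_preimage R F I' f' J' \<inter> ideal_preimage R F I f J"
        using D[of a] unfolding Int_iff[of a "ideal_preimage R F I' f' J'"] mem mem' by auto
    qed
    fix a assume a: "a \<in> ?D"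
    then obtain b where b: "a \<in> I" "a \<in> I'" "b \<in> J" "b \<in> J'" "b \<in> f a" "b \<in> f' a"
      using D by auto
    have "g' b = g b" by (rule cls_eqD[OF Y g' g b(4,3)])
    then have "descended_map J' g' (f' a) = descended_map J g (f a)"
      using descended_map_eq[OF ef' eg' b(2,6,4)] descended_map_eq[OF ef eg b(1,5,3)] by simp
    then show "(\<lambda>a\<in>ideal_preimage R F I' f' J'. descended_map J' g' (f' a)) a =
        (\<lambda>a\<in>ideal_preimage R F I f J. descended_map J g (f a)) a"
      using subsetD[OF sub a] by simp
  qed
qed

lemma S_mult_closed:
  assumes X: "X \<in> carrier S" and Y: "Y \<in> carrier S"
  shows "X \<otimes>\<^bsub>S\<^esub> Y \<in> carrier S"
proof -
  obtain I f where f: "endo I f" "(I, f) \<in> X" using carrier_rep[OF X] .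
  obtain J g where g: "endo J g" "(J, g) \<in> Y" using carrier_rep[OF Y] .
  show ?thesis unfolding S_mult_eq[OF X Y f(2) g(2)] by (rule cls_closed[OF endo_comp[OF f(1) g(1)]])
qed

lemma graph_mult:
  assumes X: "X \<in> carrier S" and Y: "Y \<in> carrier S"
    and x: "(a, x) \<in> graph X" and y: "(x, y) \<in> graph Y"
  shows "(a, y) \<in> graph (X \<otimes>\<^bsub>S\<^esub> Y)"
proof -
  obtain I f where f: "(I, f) \<in> X" "a \<in> I" "x \<in> f a" using graphE[OF x] .
  obtain J g where g: "(J, g) \<in> Y" "x \<in> J" "y \<in> g x" using graphE[OF y] .
  note ef = carrier_memD(1)[OF X f(1)] and eg = carrier_memD(1)[OF Y g(1)]
  show ?thesis
    unfolding S_mult_eq[OF X Y f(1) g(1)]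
  proof (rule graphI[OF cls_self[OF endo_comp[OF ef eg]]])
    show "a \<in> ideal_preimage R F I f J"
      unfolding preimage_iff[OF ef endo_system[OF eg]] using f(2,3) g(2) by auto
    then show "y \<in> (\<lambda>a\<in>ideal_preimage R F I f J. descended_map J g (f a)) a"
      using descended_map_eq[OF ef eg f(2,3) g(2)] g(3) by simp
  qed
qed

text \<open>The domain of a composite: iterating this lemma gives a common domain for products of several
  factors.\<close>

lemma graph_preimage:
  assumes X: "X \<in> carrier S" and J: "J \<in> F"
  obtains K where "K \<in> F" "\<forall>a\<in>K. \<exists>x\<in>J. (a, x) \<in> graph X"
proof -
  obtain I f where f: "endo I f" "(I, f) \<in> X" using carrier_rep[OF X] .
  have "\<exists>x\<in>J. (a, x) \<in> graph X" if "a \<in> ideal_preimage R F I f J" for a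
    using that graphI[OF f(2)] unfolding preimage_iff[OF f(1) J] by auto
  then show ?thesis by (intro that[OF preimage_in_system[OF f(1) J]] ballI)
qed


section \<open>The localized ring\<close>

abbreviation can where "can \<equiv> loc_canonical R F (self_module R)"

lemma can_def: "can r = cls (carrier R) (\<lambda>a\<in>carrier R. T +> (a \<otimes> r))"
  unfolding loc_canonical_def self_module_as_ideal_module ideal_module_simps ..

lemma endo_can:
  assumes r: "r \<in> carrier R"
  shows "endo (carrier R) (\<lambda>a\<in>carrier R. T +> (a \<otimes> r))" (is "endo _ ?h")
proof (rule endoI[OF carrier_in_system])
  have mem: "x \<in> ?h a \<longleftrightarrow> x \<in> carrier R \<and> T +> x = T +> (a \<otimes> r)" if "a \<in> carrier R" for a x
  proof -
    have c: "a \<otimes> r \<in> carrier R" using that r by simp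
    show ?thesis
    proof
      assume x: "x \<in> ?h a"
      then have "x \<in> carrier R" using T.mem_coset_iff[OF c, of x] that by simp
      then show "x \<in> carrier R \<and> T +> x = T +> (a \<otimes> r)"
        using T.coset_eq_iff_mem[OF _ c, of x] x that by simp
    next
      assume x: "x \<in> carrier R \<and> T +> x = T +> (a \<otimes> r)"
      then have "x \<in> T +> (a \<otimes> r)" using T.coset_eq_iff_mem[OF _ c, of x] by simp
      then show "x \<in> ?h a" using that by simp
    qed
  qed
  show "?h \<in> extensional (carrier R)" by simp
  show "\<exists>x\<in>carrier R. ?h a = T +> x" if "a \<in> carrier R" for a
    using that r by auto
  show "x \<oplus> y \<in> ?h (a \<oplus> b)"
    if ab: "a \<in> carrier R" "b \<in> carrier R" and x: "x \<in> ?h a" and y: "y \<in> ?h b" for a b x y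
  proof -
    have xc: "x \<in> carrier R" "T +> x = T +> (a \<otimes> r)" using x mem[OF ab(1)] by simp_all
    have yc: "y \<in> carrier R" "T +> y = T +> (b \<otimes> r)" using y mem[OF ab(2)] by simp_all
    have "T +> (x \<oplus> y) = set_add R (T +> x) (T +> y)"
      by (rule T.a_rcos_sum[OF xc(1) yc(1), symmetric])
    also have "\<dots> = T +> (a \<otimes> r \<oplus> b \<otimes> r)"
      unfolding xc(2) yc(2) using ab r by (intro T.a_rcos_sum) simp_all
    also have "a \<otimes> r \<oplus> b \<otimes> r = (a \<oplus> b) \<otimes> r" using ab r by (simp add: l_distr)
    finally show ?thesis using mem[of "a \<oplus> b"] ab xc(1) yc(1) by simp
  qed
  show "s \<otimes> x \<in> ?h (s \<otimes> a)"
    if s: "s \<in> carrier R" and a: "a \<in> carrier R" and x: "x \<in> ?h a" for s a x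
  proof -
    have xc: "x \<in> carrier R" "T +> x = T +> (a \<otimes> r)" using x mem[OF a] by simp_all
    have "T +> (s \<otimes> x) = T +> (s \<otimes> (a \<otimes> r))"
      using a r by (intro torsion_coset_smult[OF s xc(1) _ xc(2)]) simp
    also have "s \<otimes> (a \<otimes> r) = (s \<otimes> a) \<otimes> r" using s a r by (simp add: m_assoc)
    finally show ?thesis using mem[of "s \<otimes> a"] s a xc(1) by simp
  qed
qed

lemma can_closed: "r \<in> carrier R \<Longrightarrow> can r \<in> carrier S"
  unfolding can_def by (rule cls_closed[OF endo_can])

lemma graph_can:
  assumes "a \<in> carrier R" "r \<in> carrier R"
  shows "(a, a \<otimes> r) \<in> graph (can r)"
  unfolding can_def
proof (rule graphI[OF cls_self[OF endo_can[OF assms(2)]] assms(1)])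
  show "a \<otimes> r \<in> (\<lambda>a\<in>carrier R. T +> (a \<otimes> r)) a"
    using assms T.self_mem_coset[of "a \<otimes> r"] by simp
qed

lemma S_one: "\<one>\<^bsub>S\<^esub> = can \<one>"
proof -
  have "(\<lambda>a\<in>carrier R. T +> (a \<otimes> \<one>)) = (\<lambda>a\<in>carrier R. T +> a)"
    by (rule restrict_ext) simp
  then show ?thesis unfolding can_def unfolding loc_ring_def by simp
qed

lemma S_zero: "\<zero>\<^bsub>S\<^esub> = can \<zero>"
proof -
  have "T +> \<zero> = T" using T.coset_eq_self_iff[OF zero_closed] T.zero_closed by simp
  then have "(\<lambda>a\<in>carrier R. T +> (a \<otimes> \<zero>)) = (\<lambda>a\<in>carrier R. T)"
    by (intro restrict_ext) simp
  then show ?thesis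
    unfolding can_def
    by (simp add: loc_ring_def loc_module_def torsion_quotient_def quotient_module_simps)
qed

lemma S_mult_assoc:
  assumes X: "X \<in> carrier S" and Y: "Y \<in> carrier S" and Z: "Z \<in> carrier S"
  shows "(X \<otimes>\<^bsub>S\<^esub> Y) \<otimes>\<^bsub>S\<^esub> Z = X \<otimes>\<^bsub>S\<^esub> (Y \<otimes>\<^bsub>S\<^esub> Z)"
proof -
  obtain K1 where K1: "K1 \<in> F" "\<forall>a\<in>K1. \<exists>x. (a, x) \<in> graph Z"
    using graph_domain[OF Z] .
  obtain K2 where K2: "K2 \<in> F" "\<forall>a\<in>K2. \<exists>x\<in>K1. (a, x) \<in> graph Y"
    using graph_preimage[OF Y K1(1)] .
  obtain K3 where K3: "K3 \<in> F" "\<forall>a\<in>K3. \<exists>x\<in>K2. (a, x) \<in> graph X"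
    using graph_preimage[OF X K2(1)] .
  show ?thesis
  proof (rule graph_eqI[OF _ _ K3(1)])
    fix a assume "a \<in> K3"
    then obtain x where x: "x \<in> K2" "(a, x) \<in> graph X" using K3(2) by auto
    obtain y where y: "y \<in> K1" "(x, y) \<in> graph Y" using bspec[OF K2(2) x(1)] by auto
    obtain z where z: "(y, z) \<in> graph Z" using bspec[OF K1(2) y(1)] by auto
    have "(a, z) \<in> graph ((X \<otimes>\<^bsub>S\<^esub> Y) \<otimes>\<^bsub>S\<^esub> Z)"
      by (rule graph_mult[OF S_mult_closed[OF X Y] Z graph_mult[OF X Y x(2) y(2)] z])
    moreover have "(a, z) \<in> graph (X \<otimes>\<^bsub>S\<^esub> (Y \<otimes>\<^bsub>S\<^esub> Z))"
      by (rule graph_mult[OF X S_mult_closed[OF Y Z] x(2) graph_mult[OF Y Z y(2) z]])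
    ultimately show "\<exists>z. (a, z) \<in> graph ((X \<otimes>\<^bsub>S\<^esub> Y) \<otimes>\<^bsub>S\<^esub> Z) \<and> (a, z) \<in> graph (X \<otimes>\<^bsub>S\<^esub> (Y \<otimes>\<^bsub>S\<^esub> Z))"
      by auto
  qed (intro S_mult_closed X Y Z)+
qed

text \<open>Composition of partial linear maps from \<open>R\<close> to \<open>R / T\<close> is commutative for the reason that
  endomorphisms of the ring \<open>R\<close> as a module over itself commute: \<open>c f(a) = f(c a) = a f(c)\<close>. Here
  \<open>f\<close> is not defined at \<open>1\<close>, so elements \<open>c\<close> and \<open>d\<close> of the domains take its place and are
  cancelled at the end.\<close>

lemma S_mult_comm:
  assumes X: "X \<in> carrier S" and Y: "Y \<in> carrier S"
  shows "X \<otimes>\<^bsub>S\<^esub> Y = Y \<otimes>\<^bsub>S\<^esub> X"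
proof -
  obtain C where C: "C \<in> F" "\<forall>a\<in>C. \<exists>x. (a, x) \<in> graph X" using graph_domain[OF X] .
  obtain D where D: "D \<in> F" "\<forall>a\<in>D. \<exists>x. (a, x) \<in> graph Y" using graph_domain[OF Y] .
  obtain K where K: "K \<in> F" "\<forall>a\<in>K. \<exists>x\<in>D. (a, x) \<in> graph X"
    using graph_preimage[OF X D(1)] .
  obtain L where L: "L \<in> F" "\<forall>a\<in>L. \<exists>x\<in>C. (a, x) \<in> graph Y"
    using graph_preimage[OF Y C(1)] .
  show ?thesis
  proof (rule graph_eqI[OF _ _ system_Int[OF K(1) L(1)]])
    fix a assume a: "a \<in> K \<inter> L"
    obtain x where x: "x \<in> D" "(a, x) \<in> graph X" using K(2) a by auto
    obtain y where y: "(x, y) \<in> graph Y" using bspec[OF D(2) x(1)] by auto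
    obtain x' where x': "x' \<in> C" "(a, x') \<in> graph Y" using L(2) a by auto
    obtain y' where y': "(x', y') \<in> graph X" using bspec[OF C(2) x'(1)] by auto
    note xc = graph_carrier[OF X x(2)] and yc = graph_carrier[OF Y y]
      and xc' = graph_carrier[OF Y x'(2)] and yc' = graph_carrier[OF X y']
    \<comment> \<open>Linearity alone shows that \<open>c d y\<close> and \<open>c d y'\<close> are both congruent to \<open>a u w\<close>, where
      \<open>c X = u\<close> and \<open>d Y = w\<close>; the factors \<open>c\<close> and \<open>d\<close> are cancelled one after the other.\<close>
    have "T +> y = T +> y'"
    proof (rule torsion_coset_cancel[OF D(1) yc(2) yc'(2)])
      fix d assume d: "d \<in> D"
      obtain w where w: "(d, w) \<in> graph Y" using bspec[OF D(2) d] by auto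
      note dw = graph_carrier[OF Y w]
      have "T +> (d \<otimes> y) = T +> (x \<otimes> w)"
        using graph_coset[OF Y graph_smult[OF Y y dw(1)]] graph_smult[OF Y w xc(2)] dw xc
        by (simp add: m_comm)
      have "T +> (d \<otimes> x') = T +> (a \<otimes> w)"
        using graph_coset[OF Y graph_smult[OF Y x'(2) dw(1)]] graph_smult[OF Y w xc(1)] dw xc
        by (simp add: m_comm)
      show "T +> (d \<otimes> y) = T +> (d \<otimes> y')"
      proof (rule torsion_coset_cancel[OF C(1)])
        show "d \<otimes> y \<in> carrier R" "d \<otimes> y' \<in> carrier R" using dw yc yc' by simp_all
        fix c assume c: "c \<in> C"
        obtain u where u: "(c, u) \<in> graph X" using bspec[OF C(2) c] by auto
        note cu = graph_carrier[OF X u]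
        have cx: "T +> (c \<otimes> x) = T +> (a \<otimes> u)"
          using graph_coset[OF X graph_smult[OF X x(2) cu(1)]] graph_smult[OF X u xc(1)] cu xc
          by (simp add: m_comm)
        have cy: "T +> (c \<otimes> y') = T +> (x' \<otimes> u)"
          using graph_coset[OF X graph_smult[OF X y' cu(1)]] graph_smult[OF X u xc'(2)] cu xc'
          by (simp add: m_comm)
        have "T +> (c \<otimes> (d \<otimes> y)) = T +> (c \<otimes> (x \<otimes> w))"
          using cu dw xc yc \<open>T +> (d \<otimes> y) = T +> (x \<otimes> w)\<close> by (intro torsion_coset_smult) simp_all
        also have "c \<otimes> (x \<otimes> w) = w \<otimes> (c \<otimes> x)" using cu dw xc by (simp add: m_ac)
        also have "T +> (w \<otimes> (c \<otimes> x)) = T +> (w \<otimes> (a \<otimes> u))"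
          using cu dw xc cx by (intro torsion_coset_smult) simp_all
        also have "w \<otimes> (a \<otimes> u) = u \<otimes> (a \<otimes> w)" using cu dw xc by (simp add: m_ac)
        also have "T +> (u \<otimes> (a \<otimes> w)) = T +> (u \<otimes> (d \<otimes> x'))"
          using cu dw xc xc' \<open>T +> (d \<otimes> x') = T +> (a \<otimes> w)\<close>
          by (intro torsion_coset_smult) simp_all
        also have "u \<otimes> (d \<otimes> x') = d \<otimes> (x' \<otimes> u)" using cu dw xc' by (simp add: m_ac)
        also have "T +> (d \<otimes> (x' \<otimes> u)) = T +> (d \<otimes> (c \<otimes> y'))"
          using cu dw xc' yc' cy by (intro torsion_coset_smult) simp_all
        also have "d \<otimes> (c \<otimes> y') = c \<otimes> (d \<otimes> y')" using cu dw yc' by (simp add: m_ac)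
        finally show "T +> (c \<otimes> (d \<otimes> y)) = T +> (c \<otimes> (d \<otimes> y'))" .
      qed
    qed
    then have "(a, y) \<in> graph (Y \<otimes>\<^bsub>S\<^esub> X)"
      by (rule graph_shift[OF S_mult_closed[OF Y X] graph_mult[OF Y X x'(2) y'] yc(2)])
    moreover have "(a, y) \<in> graph (X \<otimes>\<^bsub>S\<^esub> Y)" by (rule graph_mult[OF X Y x(2) y])
    ultimately show "\<exists>z. (a, z) \<in> graph (X \<otimes>\<^bsub>S\<^esub> Y) \<and> (a, z) \<in> graph (Y \<otimes>\<^bsub>S\<^esub> X)" by auto
  qed (intro S_mult_closed X Y)+
qed

lemma S_mult_add:
  assumes X: "X \<in> carrier S" and Y: "Y \<in> carrier S" and Z: "Z \<in> carrier S"
  shows "Z \<otimes>\<^bsub>S\<^esub> (X \<oplus>\<^bsub>S\<^esub> Y) = Z \<otimes>\<^bsub>S\<^esub> X \<oplus>\<^bsub>S\<^esub> Z \<otimes>\<^bsub>S\<^esub> Y"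
proof -
  obtain C where C: "C \<in> F" "\<forall>a\<in>C. \<exists>x. (a, x) \<in> graph X" using graph_domain[OF X] .
  obtain D where D: "D \<in> F" "\<forall>a\<in>D. \<exists>x. (a, x) \<in> graph Y" using graph_domain[OF Y] .
  obtain K where K: "K \<in> F" "\<forall>a\<in>K. \<exists>x\<in>C \<inter> D. (a, x) \<in> graph Z"
    using graph_preimage[OF Z system_Int[OF C(1) D(1)]] .
  show ?thesis
  proof (rule graph_eqI[OF _ _ K(1)])
    fix a assume "a \<in> K"
    then obtain z where z: "z \<in> C" "z \<in> D" "(a, z) \<in> graph Z" using K(2) by auto
    obtain x where x: "(z, x) \<in> graph X" using bspec[OF C(2) z(1)] by auto
    obtain y where y: "(z, y) \<in> graph Y" using bspec[OF D(2) z(2)] by auto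
    have "(a, x \<oplus> y) \<in> graph (Z \<otimes>\<^bsub>S\<^esub> (X \<oplus>\<^bsub>S\<^esub> Y))"
      by (rule graph_mult[OF Z S_add_closed[OF X Y] z(3) graph_add[OF X Y x y]])
    moreover have "(a, x \<oplus> y) \<in> graph (Z \<otimes>\<^bsub>S\<^esub> X \<oplus>\<^bsub>S\<^esub> Z \<otimes>\<^bsub>S\<^esub> Y)"
      by (rule graph_add[OF S_mult_closed[OF Z X] S_mult_closed[OF Z Y]
            graph_mult[OF Z X z(3) x] graph_mult[OF Z Y z(3) y]])
    ultimately show "\<exists>t. (a, t) \<in> graph (Z \<otimes>\<^bsub>S\<^esub> (X \<oplus>\<^bsub>S\<^esub> Y)) \<and> (a, t) \<in> graph (Z \<otimes>\<^bsub>S\<^esub> X \<oplus>\<^bsub>S\<^esub> Z \<otimes>\<^bsub>S\<^esub> Y)"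
      by auto
  qed (intro S_mult_closed S_add_closed X Y Z)+
qed

lemma S_add_assoc:
  assumes X: "X \<in> carrier S" and Y: "Y \<in> carrier S" and Z: "Z \<in> carrier S"
  shows "(X \<oplus>\<^bsub>S\<^esub> Y) \<oplus>\<^bsub>S\<^esub> Z = X \<oplus>\<^bsub>S\<^esub> (Y \<oplus>\<^bsub>S\<^esub> Z)"
proof -
  obtain C where C: "C \<in> F" "\<forall>a\<in>C. \<exists>x. (a, x) \<in> graph X" using graph_domain[OF X] .
  obtain D where D: "D \<in> F" "\<forall>a\<in>D. \<exists>x. (a, x) \<in> graph Y" using graph_domain[OF Y] .
  obtain K where K: "K \<in> F" "\<forall>a\<in>K. \<exists>x. (a, x) \<in> graph Z" using graph_domain[OF Z] .
  show ?thesis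
  proof (rule graph_eqI[OF _ _ system_Int[OF system_Int[OF C(1) D(1)] K(1)]])
    fix a assume a: "a \<in> C \<inter> D \<inter> K"
    obtain x where x: "(a, x) \<in> graph X" using C(2) a by auto
    obtain y where y: "(a, y) \<in> graph Y" using D(2) a by auto
    obtain z where z: "(a, z) \<in> graph Z" using K(2) a by auto
    have "(a, x \<oplus> y \<oplus> z) \<in> graph ((X \<oplus>\<^bsub>S\<^esub> Y) \<oplus>\<^bsub>S\<^esub> Z)"
      by (rule graph_add[OF S_add_closed[OF X Y] Z graph_add[OF X Y x y] z])
    moreover have "(a, x \<oplus> (y \<oplus> z)) \<in> graph (X \<oplus>\<^bsub>S\<^esub> (Y \<oplus>\<^bsub>S\<^esub> Z))"
      by (rule graph_add[OF X S_add_closed[OF Y Z] x graph_add[OF Y Z y z]])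
    moreover have "x \<oplus> y \<oplus> z = x \<oplus> (y \<oplus> z)"
      by (rule a_assoc[OF graph_carrier(2)[OF X x] graph_carrier(2)[OF Y y] graph_carrier(2)[OF Z z]])
    ultimately show "\<exists>t. (a, t) \<in> graph ((X \<oplus>\<^bsub>S\<^esub> Y) \<oplus>\<^bsub>S\<^esub> Z) \<and> (a, t) \<in> graph (X \<oplus>\<^bsub>S\<^esub> (Y \<oplus>\<^bsub>S\<^esub> Z))"
      by auto
  qed (intro S_add_closed X Y Z)+
qed

lemma S_add_comm:
  assumes X: "X \<in> carrier S" and Y: "Y \<in> carrier S"
  shows "X \<oplus>\<^bsub>S\<^esub> Y = Y \<oplus>\<^bsub>S\<^esub> X"
proof -
  obtain C where C: "C \<in> F" "\<forall>a\<in>C. \<exists>x. (a, x) \<in> graph X" using graph_domain[OF X] .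
  obtain D where D: "D \<in> F" "\<forall>a\<in>D. \<exists>x. (a, x) \<in> graph Y" using graph_domain[OF Y] .
  show ?thesis
  proof (rule graph_eqI[OF S_add_closed[OF X Y] S_add_closed[OF Y X] system_Int[OF C(1) D(1)]])
    fix a assume a: "a \<in> C \<inter> D"
    obtain x where x: "(a, x) \<in> graph X" using C(2) a by auto
    obtain y where y: "(a, y) \<in> graph Y" using D(2) a by auto
    have "x \<oplus> y = y \<oplus> x" by (rule a_comm[OF graph_carrier(2)[OF X x] graph_carrier(2)[OF Y y]])
    then show "\<exists>t. (a, t) \<in> graph (X \<oplus>\<^bsub>S\<^esub> Y) \<and> (a, t) \<in> graph (Y \<oplus>\<^bsub>S\<^esub> X)"
      using graph_add[OF X Y x y] graph_add[OF Y X y x] by auto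
  qed
qed

lemma S_zero_add:
  assumes X: "X \<in> carrier S"
  shows "\<zero>\<^bsub>S\<^esub> \<oplus>\<^bsub>S\<^esub> X = X"
proof -
  obtain C where C: "C \<in> F" "\<forall>a\<in>C. \<exists>x. (a, x) \<in> graph X" using graph_domain[OF X] .
  have Z: "can \<zero> \<in> carrier S" by (rule can_closed[OF zero_closed])
  show ?thesis
    unfolding S_zero
  proof (rule graph_eqI[OF S_add_closed[OF Z X] X C(1)])
    fix a assume a: "a \<in> C"
    obtain x where x: "(a, x) \<in> graph X" using bspec[OF C(2) a] by auto
    note c = graph_carrier[OF X x]
    have "(a, \<zero> \<oplus> x) \<in> graph (can \<zero> \<oplus>\<^bsub>S\<^esub> X)"
      using graph_add[OF Z X graph_can[OF c(1) zero_closed] x] c by simp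
    then show "\<exists>x. (a, x) \<in> graph (can \<zero> \<oplus>\<^bsub>S\<^esub> X) \<and> (a, x) \<in> graph X" using x c by auto
  qed
qed

lemma S_one_mult:
  assumes X: "X \<in> carrier S"
  shows "\<one>\<^bsub>S\<^esub> \<otimes>\<^bsub>S\<^esub> X = X"
proof -
  obtain C where C: "C \<in> F" "\<forall>a\<in>C. \<exists>x. (a, x) \<in> graph X" using graph_domain[OF X] .
  have Z: "can \<one> \<in> carrier S" by (rule can_closed[OF one_closed])
  show ?thesis
    unfolding S_one
  proof (rule graph_eqI[OF S_mult_closed[OF Z X] X C(1)])
    fix a assume a: "a \<in> C"
    obtain x where x: "(a, x) \<in> graph X" using bspec[OF C(2) a] by auto
    note c = graph_carrier[OF X x]
    have "(a, a) \<in> graph (can \<one>)" using graph_can[OF c(1) one_closed] c by simp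
    from graph_mult[OF Z X this x]
    show "\<exists>x. (a, x) \<in> graph (can \<one> \<otimes>\<^bsub>S\<^esub> X) \<and> (a, x) \<in> graph X" using x by auto
  qed
qed

lemma S_add_inverse:
  assumes X: "X \<in> carrier S"
  shows "(X \<otimes>\<^bsub>S\<^esub> can (\<ominus> \<one>)) \<oplus>\<^bsub>S\<^esub> X = \<zero>\<^bsub>S\<^esub>"
proof -
  obtain C where C: "C \<in> F" "\<forall>a\<in>C. \<exists>x. (a, x) \<in> graph X" using graph_domain[OF X] .
  have N: "can (\<ominus> \<one>) \<in> carrier S" by (intro can_closed) simp
  have XN: "X \<otimes>\<^bsub>S\<^esub> can (\<ominus> \<one>) \<in> carrier S" by (rule S_mult_closed[OF X N])
  show ?thesis
    unfolding S_zero
  proof (rule graph_eqI[OF S_add_closed[OF XN X] can_closed[OF zero_closed] C(1)])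
    fix a assume a: "a \<in> C"
    obtain x where x: "(a, x) \<in> graph X" using bspec[OF C(2) a] by auto
    note c = graph_carrier[OF X x]
    have m: "\<ominus> \<one> \<in> carrier R" by simp
    have "(a, x \<otimes> \<ominus> \<one> \<oplus> x) \<in> graph ((X \<otimes>\<^bsub>S\<^esub> can (\<ominus> \<one>)) \<oplus>\<^bsub>S\<^esub> X)"
      by (rule graph_add[OF XN X graph_mult[OF X N x graph_can[OF c(2) m]] x])
    moreover have "x \<otimes> \<ominus> \<one> \<oplus> x = a \<otimes> \<zero>" using c by (simp add: r_minus l_neg)
    ultimately show "\<exists>t. (a, t) \<in> graph ((X \<otimes>\<^bsub>S\<^esub> can (\<ominus> \<one>)) \<oplus>\<^bsub>S\<^esub> X) \<and> (a, t) \<in> graph (can \<zero>)"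
      using graph_can[OF c(1) zero_closed] by auto
  qed
qed

lemma S_cring: "cring S"
proof (rule cringI)
  show "abelian_group S"
  proof (rule abelian_groupI)
    show "\<zero>\<^bsub>S\<^esub> \<in> carrier S" unfolding S_zero by (rule can_closed[OF zero_closed])
    show "\<exists>Y\<in>carrier S. Y \<oplus>\<^bsub>S\<^esub> X = \<zero>\<^bsub>S\<^esub>" if X: "X \<in> carrier S" for X
      by (intro bexI[of _ "X \<otimes>\<^bsub>S\<^esub> can (\<ominus> \<one>)"] S_add_inverse[OF X] S_mult_closed[OF X] can_closed) simp
  qed (fact S_add_closed S_add_assoc S_add_comm S_zero_add)+
  show "comm_monoid S"
  proof (rule comm_monoidI)
    show "\<one>\<^bsub>S\<^esub> \<in> carrier S" unfolding S_one by (rule can_closed[OF one_closed])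
  qed (fact S_mult_closed S_mult_assoc S_mult_comm S_one_mult)+
  fix X Y Z assume XYZ: "X \<in> carrier S" "Y \<in> carrier S" "Z \<in> carrier S"
  show "(X \<oplus>\<^bsub>S\<^esub> Y) \<otimes>\<^bsub>S\<^esub> Z = X \<otimes>\<^bsub>S\<^esub> Z \<oplus>\<^bsub>S\<^esub> Y \<otimes>\<^bsub>S\<^esub> Z"
    using S_mult_add[OF XYZ] S_mult_comm[OF S_add_closed[OF XYZ(1,2)] XYZ(3)]
      S_mult_comm[OF XYZ(1,3)] S_mult_comm[OF XYZ(2,3)] by simp
qed

lemma can_add:
  assumes r: "r \<in> carrier R" and s: "s \<in> carrier R"
  shows "can (r \<oplus> s) = can r \<oplus>\<^bsub>S\<^esub> can s"
proof (rule graph_eqI[OF _ _ carrier_in_system])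
  show "can (r \<oplus> s) \<in> carrier S" using r s by (intro can_closed) simp
  show "can r \<oplus>\<^bsub>S\<^esub> can s \<in> carrier S" by (intro S_add_closed can_closed r s)
  fix a assume a: "a \<in> carrier R"
  have "(a, a \<otimes> r \<oplus> a \<otimes> s) \<in> graph (can r \<oplus>\<^bsub>S\<^esub> can s)"
    by (rule graph_add[OF can_closed[OF r] can_closed[OF s] graph_can[OF a r] graph_can[OF a s]])
  moreover have "(a, a \<otimes> (r \<oplus> s)) \<in> graph (can (r \<oplus> s))" using r s by (intro graph_can a) simp
  ultimately show "\<exists>x. (a, x) \<in> graph (can (r \<oplus> s)) \<and> (a, x) \<in> graph (can r \<oplus>\<^bsub>S\<^esub> can s)"
    using a r s by (auto simp: r_distr)
qed

lemma can_mult: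
  assumes r: "r \<in> carrier R" and s: "s \<in> carrier R"
  shows "can (r \<otimes> s) = can r \<otimes>\<^bsub>S\<^esub> can s"
proof (rule graph_eqI[OF _ _ carrier_in_system])
  show "can (r \<otimes> s) \<in> carrier S" using r s by (intro can_closed) simp
  show "can r \<otimes>\<^bsub>S\<^esub> can s \<in> carrier S" by (intro S_mult_closed can_closed r s)
  fix a assume a: "a \<in> carrier R"
  have ar: "a \<otimes> r \<in> carrier R" using a r by simp
  have "(a, (a \<otimes> r) \<otimes> s) \<in> graph (can r \<otimes>\<^bsub>S\<^esub> can s)"
    by (rule graph_mult[OF can_closed[OF r] can_closed[OF s] graph_can[OF a r] graph_can[OF ar s]])
  moreover have "(a, a \<otimes> (r \<otimes> s)) \<in> graph (can (r \<otimes> s))" using r s by (intro graph_can a) simp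
  ultimately show "\<exists>x. (a, x) \<in> graph (can (r \<otimes> s)) \<and> (a, x) \<in> graph (can r \<otimes>\<^bsub>S\<^esub> can s)"
    using a r s by (auto simp: m_assoc)
qed

text \<open>This equation is the meaning of the graph.\<close>

lemma can_mult_graph:
  assumes X: "X \<in> carrier S" and x: "(a, x) \<in> graph X"
  shows "can a \<otimes>\<^bsub>S\<^esub> X = can x"
proof -
  note c = graph_carrier[OF X x]
  show ?thesis
  proof (rule graph_eqI[OF S_mult_closed[OF can_closed[OF c(1)] X] can_closed[OF c(2)] carrier_in_system])
    fix b assume b: "b \<in> carrier R"
    have "(b, b \<otimes> x) \<in> graph (can a \<otimes>\<^bsub>S\<^esub> X)"
      by (rule graph_mult[OF can_closed[OF c(1)] X graph_can[OF b c(1)] graph_smult[OF X x b]])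
    then show "\<exists>y. (b, y) \<in> graph (can a \<otimes>\<^bsub>S\<^esub> X) \<and> (b, y) \<in> graph (can x)"
      using graph_can[OF b c(2)] by auto
  qed
qed


section \<open>Localization of ideals and contraction\<close>

text \<open>For \<open>p\<close> containing \<open>F(R)\<close>, the inclusion of \<open>p\<close> into \<open>R\<close> induces an inclusion of sets of
  cosets, so the localized inclusion sends the class of \<open>f\<close> for \<open>p\<close> to the class of the same \<open>f\<close>
  for \<open>R\<close>.\<close>

lemma induced_map_id:
  assumes f: "endo I f" and a: "a \<in> I"
  shows "induced_map R F (self_module R) (\<lambda>x. x) (f a) = f a"
proof -
  have "a_r_coset (self_module R) = a_r_coset R"
    unfolding self_module_as_ideal_module by (rule ideal_module_simps)
  then have "induced_map R F (self_module R) (\<lambda>x. x) (f a) = (\<Union>x\<in>f a. T +> x)"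
    unfolding induced_map_def by simp
  also have "\<dots> = f a"
  proof (rule SUP_eq_const)
    show "f a \<noteq> {}" using endo_nonempty[OF f a] by auto
    show "T +> x = f a" if "x \<in> f a" for x by (rule endo_coset(2)[OF f a that, symmetric])
  qed
  finally show ?thesis .
qed

lemma loc_map_class:
  assumes p: "ideal p R" "T \<subseteq> p" and f: "partial_map p I f"
  shows "loc_map R F (self_module R) (\<lambda>x. x) (loc_rel R F (ideal_module R p) `` {(I, f)}) = cls I f"
    (is "loc_map _ _ _ _ ?X = _")
  unfolding loc_map_def
proof (rule SUP_eq_const)
  have "(I, f) \<in> ?X" using f by (simp add: loc_rel_iff[OF p])
  then show "?X \<noteq> {}" by auto
  fix u assume u: "u \<in> ?X"
  obtain J g where Jg: "u = (J, g)" by (metis surj_pair)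
  have rel: "partial_map p I f \<and> partial_map p J g \<and> (\<forall>a\<in>I \<inter> J. f a = g a)"
    using u unfolding Jg by (simp add: loc_rel_iff[OF p])
  have ef: "endo I f" by (rule partial_map_endo[OF p(1) f])
  have eg: "endo J g" by (rule partial_map_endo[OF p(1) conjunct1[OF conjunct2[OF rel]]])
  have "(\<lambda>a\<in>J. induced_map R F (self_module R) (\<lambda>x. x) (g a)) = restrict g J"
    by (rule restrict_ext) (rule induced_map_id[OF eg])
  also have "\<dots> = g" using eg unfolding partial_map_def by (intro extensional_restrict) simp
  finally have "cls J (\<lambda>a\<in>J. induced_map R F (self_module R) (\<lambda>x. x) (g a)) = cls J g" by simp
  also have "\<dots> = cls I f"
  proof (rule cls_eqI[OF eg ef system_Int[OF endo_system[OF ef] endo_system[OF eg]]])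
    show "I \<inter> J \<subseteq> J \<inter> I" by auto
    show "g a = f a" if "a \<in> I \<inter> J" for a
      using bspec[OF conjunct2[OF conjunct2[OF rel]] that] by simp
  qed
  finally show "(case u of (I, f) \<Rightarrow> cls I (\<lambda>a\<in>I. induced_map R F (self_module R) (\<lambda>x. x) (f a))) = cls I f"
    unfolding Jg by simp
qed

text \<open>If \<open>I X\<close> lies in \<open>p\<close>, a representative of \<open>X\<close> restricted to \<open>I\<close> takes values in
  \<open>p / F(R)\<close> and hence represents an element of the localization of \<open>p\<close>.\<close>

lemma loc_ideal_iff:
  assumes p: "ideal p R" "T \<subseteq> p"
  shows "X \<in> loc_ideal R F p \<longleftrightarrow>
    X \<in> carrier S \<and> (\<exists>I\<in>F. \<forall>a\<in>I. \<exists>x\<in>p. (a, x) \<in> graph X)"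
proof
  have pc: "p \<subseteq> carrier R" by (rule additive_subgroup.a_subset[OF ideal.axioms(1)[OF p(1)]])
  note pm_iff = partial_map_iff_endo[OF pc]
  have carr: "carrier (loc_module R F (ideal_module R p)) =
      loc_pairs R F (ideal_module R p) // loc_rel R F (ideal_module R p)"
    by (simp add: loc_module_def)
  {
    assume "X \<in> loc_ideal R F p"
    then obtain Y where Y: "Y \<in> loc_pairs R F (ideal_module R p) // loc_rel R F (ideal_module R p)"
      "X = loc_map R F (self_module R) (\<lambda>x. x) Y"
      unfolding loc_ideal_def carr by auto
    obtain u where u: "u \<in> loc_pairs R F (ideal_module R p)" "Y = loc_rel R F (ideal_module R p) `` {u}"
      using Y(1) by (rule quotientE)
    obtain I f where If: "u = (I, f)" by (metis surj_pair)
    have pm: "partial_map p I f" using u(1) unfolding If loc_pairs_iff[OF p] .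
    have f: "endo I f" by (rule partial_map_endo[OF p(1) pm])
    have X: "X = cls I f" unfolding Y(2) u(2) If by (rule loc_map_class[OF p pm])
    have "\<exists>x\<in>p. (a, x) \<in> graph X" if a: "a \<in> I" for a
    proof -
      obtain x where "x \<in> p" "x \<in> f a" using pm a unfolding pm_iff by auto
      then show ?thesis unfolding X using graphI[OF cls_self[OF f] a] by auto
    qed
    then show "X \<in> carrier S \<and> (\<exists>I\<in>F. \<forall>a\<in>I. \<exists>x\<in>p. (a, x) \<in> graph X)"
      using cls_closed[OF f] endo_system[OF f] X by auto
  }
  assume "X \<in> carrier S \<and> (\<exists>I\<in>F. \<forall>a\<in>I. \<exists>x\<in>p. (a, x) \<in> graph X)"
  then obtain I where X: "X \<in> carrier S" and I: "I \<in> F" "\<forall>a\<in>I. \<exists>x\<in>p. (a, x) \<in> graph X" by auto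
  obtain J f where f: "endo J f" "(J, f) \<in> X" "X = cls J f" using carrier_rep[OF X] .
  have K: "I \<inter> J \<in> F" by (rule system_Int[OF I(1) endo_system[OF f(1)]])
  have g: "endo (I \<inter> J) (restrict f (I \<inter> J))" by (rule endo_restrict[OF f(1) K]) simp
  have "\<exists>x\<in>p. x \<in> restrict f (I \<inter> J) a" if a: "a \<in> I \<inter> J" for a
  proof -
    obtain x where x: "x \<in> p" "(a, x) \<in> graph X" using bspec[OF I(2), of a] a by auto
    obtain J' f' where f': "(J', f') \<in> X" "a \<in> J'" "x \<in> f' a" using graphE[OF x(2)] .
    have "f a = f' a" using a by (intro cls_eqD[OF X f(2) f'(1) _ f'(2)]) simp
    then show ?thesis using x(1) f'(3) a by auto
  qed
  then have pm: "partial_map p (I \<inter> J) (restrict f (I \<inter> J))" unfolding pm_iff using g by simp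
  have "X = cls (I \<inter> J) (restrict f (I \<inter> J))"
    unfolding f(3) by (rule cls_eqI[OF f(1) g K]) auto
  also have "\<dots> = loc_map R F (self_module R) (\<lambda>x. x)
      (loc_rel R F (ideal_module R p) `` {(I \<inter> J, restrict f (I \<inter> J))})"
    by (rule loc_map_class[OF p pm, symmetric])
  finally show "X \<in> loc_ideal R F p"
    unfolding loc_ideal_def carr
  proof (rule image_eqI)
    show "loc_rel R F (ideal_module R p) `` {(I \<inter> J, restrict f (I \<inter> J))}
        \<in> loc_pairs R F (ideal_module R p) // loc_rel R F (ideal_module R p)"
      by (rule quotientI) (simp add: loc_pairs_iff[OF p] pm)
  qed
qed

lemma loc_system_iff:
  assumes P: "ideal P S"
  shows "P \<in> loc_system R F \<longleftrightarrow>
    (\<forall>X\<in>carrier S. {r \<in> carrier R. can r \<otimes>\<^bsub>S\<^esub> X \<in> P} \<in> F)"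
proof -
  let ?M = "scalars_via can S"
  have ann: "annihilator R (quotient_module ?M P) (P +>\<^bsub>S\<^esub> X) = {r \<in> carrier R. can r \<otimes>\<^bsub>S\<^esub> X \<in> P}"
    if X: "X \<in> carrier S" for X
    by (rule ideal.annihilator_coset[OF P _ _ can_closed X]) (simp_all add: scalars_via_simps)
  have "negligible R F (quotient_module ?M P) \<longleftrightarrow>
      (\<forall>X\<in>carrier S. annihilator R (quotient_module ?M P) (P +>\<^bsub>S\<^esub> X) \<in> F)"
    unfolding negligible_def quotient_module_simps(1) scalars_via_simps by auto
  also have "\<dots> \<longleftrightarrow> (\<forall>X\<in>carrier S. {r \<in> carrier R. can r \<otimes>\<^bsub>S\<^esub> X \<in> P} \<in> F)"
    by (rule ball_cong[OF refl]) (simp add: ann)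
  finally show ?thesis unfolding loc_system_def using P by simp
qed

definition contraction where "contraction P = {r \<in> carrier R. can r \<in> P}"

lemma prime_not_in_system:
  assumes p: "primeideal p R" "p \<notin> F" and I: "I \<in> F"
  obtains a where "a \<in> I" "a \<notin> p"
proof -
  have "\<not> I \<subseteq> p" using system_upward[OF I primeideal.axioms(1)[OF p(1)]] p(2) by auto
  then show ?thesis using that by auto
qed

lemma contraction_loc_ideal:
  assumes p: "primeideal p R" "p \<notin> F"
  shows "contraction (loc_ideal R F p) = p"
proof -
  interpret p: primeideal p R by (rule p(1))
  note Tp = torsion_le_prime[OF p]
  note loc = loc_ideal_iff[OF p.is_ideal Tp]
  have "can r \<in> loc_ideal R F p \<longleftrightarrow> r \<in> p" if r: "r \<in> carrier R" for r
  proof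
    assume "can r \<in> loc_ideal R F p"
    then obtain I where I: "I \<in> F" "\<forall>a\<in>I. \<exists>x\<in>p. (a, x) \<in> graph (can r)" unfolding loc by auto
    obtain a where a: "a \<in> I" "a \<notin> p" using prime_not_in_system[OF p I(1)] .
    have ac: "a \<in> carrier R" by (rule system_carrier[OF I(1) a(1)])
    obtain x where x: "x \<in> p" "(a, x) \<in> graph (can r)" using bspec[OF I(2) a(1)] by auto
    have "a \<otimes> r \<ominus> x \<in> p"
      using graph_unique[OF can_closed[OF r] graph_can[OF ac r] x(2)] Tp by auto
    then have "(a \<otimes> r \<ominus> x) \<oplus> x \<in> p" by (rule p.a_closed[OF _ x(1)])
    moreover have "(a \<otimes> r \<ominus> x) \<oplus> x = a \<otimes> r"
      using ac r p.Icarr[OF x(1)] by (simp add: minus_eq a_assoc l_neg)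
    ultimately show "r \<in> p" using p.I_prime[OF ac r] a(2) by simp
  next
    assume rp: "r \<in> p"
    have "\<exists>x\<in>p. (a, x) \<in> graph (can r)" if "a \<in> carrier R" for a
      using graph_can[OF that r] p.I_l_closed[OF rp that] by auto
    then show "can r \<in> loc_ideal R F p"
      unfolding loc using can_closed[OF r] carrier_in_system by auto
  qed
  then show ?thesis unfolding contraction_def using p.Icarr by auto
qed

text \<open>Elements \<open>X\<close> and \<open>Y\<close> outside the localized ideal satisfy \<open>a X = x\<close> and \<open>b Y = y\<close> with \<open>x\<close>
  and \<open>y\<close> outside \<open>p\<close>. Then \<open>x y = a b X Y\<close>, and by contraction \<open>X Y\<close> in the localized ideal would
  put \<open>x y\<close> into \<open>p\<close>.\<close>

lemma loc_ideal_prime: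
  assumes p: "primeideal p R" "p \<notin> F"
  shows "primeideal (loc_ideal R F p) S"
proof -
  interpret p: primeideal p R by (rule p(1))
  note Tp = torsion_le_prime[OF p]
  note loc = loc_ideal_iff[OF p.is_ideal Tp]
  have can_iff: "can r \<in> loc_ideal R F p \<longleftrightarrow> r \<in> p" if "r \<in> carrier R" for r
    using contraction_loc_ideal[OF p] that unfolding contraction_def by auto
  have ideal: "ideal (loc_ideal R F p) S"
  proof (rule cring.ideal_from_closure[OF S_cring])
    show "loc_ideal R F p \<subseteq> carrier S" using loc by auto
    show "\<zero>\<^bsub>S\<^esub> \<in> loc_ideal R F p"
      unfolding S_zero can_iff[OF zero_closed] by (rule p.zero_closed)
    fix X Y assume X: "X \<in> loc_ideal R F p"
    then obtain I where XS: "X \<in> carrier S" and I: "I \<in> F" "\<forall>a\<in>I. \<exists>x\<in>p. (a, x) \<in> graph X"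
      unfolding loc by auto
    {
      assume "Y \<in> loc_ideal R F p"
      then obtain J where YS: "Y \<in> carrier S" and J: "J \<in> F" "\<forall>a\<in>J. \<exists>x\<in>p. (a, x) \<in> graph Y"
        unfolding loc by auto
      have ex: "\<exists>x\<in>p. (a, x) \<in> graph (X \<oplus>\<^bsub>S\<^esub> Y)" if a: "a \<in> I \<inter> J" for a
      proof -
        obtain x where x: "x \<in> p" "(a, x) \<in> graph X" using I(2) a by auto
        obtain y where y: "y \<in> p" "(a, y) \<in> graph Y" using J(2) a by auto
        show ?thesis using graph_add[OF XS YS x(2) y(2)] p.a_closed[OF x(1) y(1)] by auto
      qed
      show "X \<oplus>\<^bsub>S\<^esub> Y \<in> loc_ideal R F p"
        unfolding loc
        by (intro conjI S_add_closed[OF XS YS] bexI[of _ "I \<inter> J"] ballI ex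
            system_Int[OF I(1) J(1)])
    }
    assume YS: "Y \<in> carrier S"
    obtain K where K: "K \<in> F" "\<forall>a\<in>K. \<exists>x\<in>I. (a, x) \<in> graph Y"
      using graph_preimage[OF YS I(1)] .
    have ex: "\<exists>x\<in>p. (a, x) \<in> graph (Y \<otimes>\<^bsub>S\<^esub> X)" if a: "a \<in> K" for a
    proof -
      obtain b where b: "b \<in> I" "(a, b) \<in> graph Y" using K(2) a by auto
      obtain x where x: "x \<in> p" "(b, x) \<in> graph X" using I(2) b(1) by auto
      show ?thesis using graph_mult[OF YS XS b(2) x(2)] x(1) by auto
    qed
    show "Y \<otimes>\<^bsub>S\<^esub> X \<in> loc_ideal R F p"
      unfolding loc by (intro conjI S_mult_closed[OF YS XS] bexI[of _ K] ballI ex K(1))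
  qed
  interpret S: cring S by (rule S_cring)
  show ?thesis
  proof (rule primeidealI[OF ideal S_cring])
    have "\<one> \<notin> p" using p.one_imp_carrier p.I_notcarr by auto
    then have "can \<one> \<notin> loc_ideal R F p" using can_iff[OF one_closed] by simp
    then show "carrier S \<noteq> loc_ideal R F p" using can_closed[OF one_closed] by auto
    fix X Y assume XS: "X \<in> carrier S" and YS: "Y \<in> carrier S" and XY: "X \<otimes>\<^bsub>S\<^esub> Y \<in> loc_ideal R F p"
    have witness: "\<exists>a x. (a, x) \<in> graph Z \<and> x \<notin> p" if Z: "Z \<in> carrier S" "Z \<notin> loc_ideal R F p" for Z
    proof (rule ccontr)
      assume none: "\<not> (\<exists>a x. (a, x) \<in> graph Z \<and> x \<notin> p)"
      obtain I where I: "I \<in> F" "\<forall>a\<in>I. \<exists>x. (a, x) \<in> graph Z" using graph_domain[OF Z(1)] .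
      have "\<forall>a\<in>I. \<exists>x\<in>p. (a, x) \<in> graph Z" using I(2) none by metis
      then have "Z \<in> loc_ideal R F p" unfolding loc using Z(1) I(1) by auto
      then show False using Z(2) by simp
    qed
    show "X \<in> loc_ideal R F p \<or> Y \<in> loc_ideal R F p"
    proof (rule ccontr)
      assume not: "\<not> (X \<in> loc_ideal R F p \<or> Y \<in> loc_ideal R F p)"
      obtain a x where x: "(a, x) \<in> graph X" "x \<notin> p" using witness[OF XS] not by auto
      obtain b y where y: "(b, y) \<in> graph Y" "y \<notin> p" using witness[OF YS] not by auto
      note xc = graph_carrier[OF XS x(1)] and yc = graph_carrier[OF YS y(1)]
      have "can (x \<otimes> y) = (can a \<otimes>\<^bsub>S\<^esub> X) \<otimes>\<^bsub>S\<^esub> (can b \<otimes>\<^bsub>S\<^esub> Y)"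
        unfolding can_mult_graph[OF XS x(1)] can_mult_graph[OF YS y(1)]
        by (rule can_mult[OF xc(2) yc(2)])
      also have "\<dots> = (can a \<otimes>\<^bsub>S\<^esub> can b) \<otimes>\<^bsub>S\<^esub> (X \<otimes>\<^bsub>S\<^esub> Y)"
        using can_closed[OF xc(1)] can_closed[OF yc(1)] XS YS by (simp add: S.m_ac)
      also have "\<dots> \<in> loc_ideal R F p"
        using can_closed[OF xc(1)] can_closed[OF yc(1)]
        by (intro ideal.I_l_closed[OF ideal XY]) simp
      finally have "x \<otimes> y \<in> p" using can_iff[of "x \<otimes> y"] xc(2) yc(2) by simp
      then show False using p.I_prime[OF xc(2) yc(2)] x(2) y(2) by simp
    qed
  qed
qed

text \<open>The annihilator of the coset of \<open>1\<close> is the contraction, which is \<open>p\<close>.\<close>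

lemma loc_ideal_not_in_system:
  assumes p: "primeideal p R" "p \<notin> F"
  shows "loc_ideal R F p \<notin> loc_system R F"
proof
  interpret P: primeideal "loc_ideal R F p" S by (rule loc_ideal_prime[OF p])
  assume "loc_ideal R F p \<in> loc_system R F"
  then have "{r \<in> carrier R. can r \<otimes>\<^bsub>S\<^esub> \<one>\<^bsub>S\<^esub> \<in> loc_ideal R F p} \<in> F"
    unfolding loc_system_iff[OF P.is_ideal] by simp
  moreover have "{r \<in> carrier R. can r \<otimes>\<^bsub>S\<^esub> \<one>\<^bsub>S\<^esub> \<in> loc_ideal R F p} = contraction (loc_ideal R F p)"
    unfolding contraction_def using can_closed by auto
  ultimately show False using contraction_loc_ideal[OF p] p(2) by simp
qed

lemma transporter_ideal:
  assumes P: "ideal P S" and X: "X \<in> carrier S"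
  shows "ideal {r \<in> carrier R. can r \<otimes>\<^bsub>S\<^esub> X \<in> P} R"
proof -
  interpret P: ideal P S by (rule P)
  show ?thesis
  proof (rule ideal_from_closure)
    show "{r \<in> carrier R. can r \<otimes>\<^bsub>S\<^esub> X \<in> P} \<subseteq> carrier R" by auto
    show "\<zero> \<in> {r \<in> carrier R. can r \<otimes>\<^bsub>S\<^esub> X \<in> P}"
      using X by (simp add: S_zero[symmetric])
  next
    fix r s assume rs: "r \<in> {r \<in> carrier R. can r \<otimes>\<^bsub>S\<^esub> X \<in> P}" "s \<in> {r \<in> carrier R. can r \<otimes>\<^bsub>S\<^esub> X \<in> P}"
    then have c: "r \<in> carrier R" "s \<in> carrier R" by auto
    have "can (r \<oplus> s) \<otimes>\<^bsub>S\<^esub> X = can r \<otimes>\<^bsub>S\<^esub> X \<oplus>\<^bsub>S\<^esub> can s \<otimes>\<^bsub>S\<^esub> X"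
      unfolding can_add[OF c] by (rule P.l_distr[OF can_closed[OF c(1)] can_closed[OF c(2)] X])
    then show "r \<oplus> s \<in> {r \<in> carrier R. can r \<otimes>\<^bsub>S\<^esub> X \<in> P}"
      using rs by (simp add: P.a_closed)
  next
    fix r s assume rs: "r \<in> carrier R" "s \<in> {r \<in> carrier R. can r \<otimes>\<^bsub>S\<^esub> X \<in> P}"
    then have c: "s \<in> carrier R" and sX: "can s \<otimes>\<^bsub>S\<^esub> X \<in> P" by auto
    have "can (r \<otimes> s) \<otimes>\<^bsub>S\<^esub> X = can r \<otimes>\<^bsub>S\<^esub> (can s \<otimes>\<^bsub>S\<^esub> X)"
      unfolding can_mult[OF rs(1) c] by (rule P.m_assoc[OF can_closed[OF rs(1)] can_closed[OF c] X])
    then show "r \<otimes> s \<in> {r \<in> carrier R. can r \<otimes>\<^bsub>S\<^esub> X \<in> P}"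
      using rs(1) c P.I_l_closed[OF sX can_closed[OF rs(1)]] by simp
  qed
qed

lemma contraction_prime:
  assumes P: "primeideal P S"
  shows "primeideal (contraction P) R"
proof -
  interpret P: primeideal P S by (rule P)
  have eq: "contraction P = {r \<in> carrier R. can r \<otimes>\<^bsub>S\<^esub> \<one>\<^bsub>S\<^esub> \<in> P}"
    unfolding contraction_def using can_closed by auto
  show ?thesis
  proof (rule primeidealI)
    show "ideal (contraction P) R"
      unfolding eq by (rule transporter_ideal[OF P.is_ideal P.one_closed])
    show "cring R" by (rule is_cring)
    have "\<one>\<^bsub>S\<^esub> \<notin> P" using P.one_imp_carrier P.I_notcarr by auto
    then have "\<one> \<notin> contraction P" unfolding contraction_def S_one by simp
    then show "carrier R \<noteq> contraction P" using one_closed by auto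
    fix a b assume a: "a \<in> carrier R" and b: "b \<in> carrier R" and "a \<otimes> b \<in> contraction P"
    then have "can a \<otimes>\<^bsub>S\<^esub> can b \<in> P" unfolding contraction_def by (simp add: can_mult)
    then show "a \<in> contraction P \<or> b \<in> contraction P"
      unfolding contraction_def using P.I_prime[OF can_closed[OF a] can_closed[OF b]] a b by simp
  qed
qed

text \<open>The contraction of \<open>P\<close> annihilates every coset of \<open>P\<close>.\<close>

lemma contraction_not_in_system:
  assumes P: "primeideal P S" "P \<notin> loc_system R F"
  shows "contraction P \<notin> F"
proof
  interpret P: primeideal P S by (rule P(1))
  assume p: "contraction P \<in> F"
  have "{r \<in> carrier R. can r \<otimes>\<^bsub>S\<^esub> X \<in> P} \<in> F" if X: "X \<in> carrier S" for X
  proof (rule system_upward[OF p transporter_ideal[OF P.is_ideal X]])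
    show "contraction P \<subseteq> {r \<in> carrier R. can r \<otimes>\<^bsub>S\<^esub> X \<in> P}"
      unfolding contraction_def using P.I_r_closed[OF _ X] by auto
  qed
  then show False using P(2) unfolding loc_system_iff[OF P.is_ideal] by simp
qed

text \<open>Primality of \<open>P\<close> gives one inclusion: \<open>a X\<close> is in \<open>P\<close> for some \<open>a\<close> outside the contraction. For
  the other, \<open>a X = x\<close> with \<open>X\<close> in \<open>P\<close> puts \<open>x\<close> into the contraction.\<close>

lemma loc_ideal_contraction:
  assumes P: "primeideal P S" "P \<notin> loc_system R F"
  shows "loc_ideal R F (contraction P) = P"
proof -
  interpret P: primeideal P S by (rule P(1))
  note p = contraction_prime[OF P(1)] contraction_not_in_system[OF P]
  note loc = loc_ideal_iff[OF primeideal.axioms(1)[OF p(1)] torsion_le_prime[OF p]]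
  show ?thesis
  proof
    show "loc_ideal R F (contraction P) \<subseteq> P"
    proof
      fix X assume "X \<in> loc_ideal R F (contraction P)"
      then obtain I where X: "X \<in> carrier S" and I: "I \<in> F" "\<forall>a\<in>I. \<exists>x\<in>contraction P. (a, x) \<in> graph X"
        unfolding loc by auto
      obtain a where a: "a \<in> I" "a \<notin> contraction P" using prime_not_in_system[OF p I(1)] .
      obtain x where x: "x \<in> contraction P" "(a, x) \<in> graph X" using I(2) a(1) by auto
      have ac: "a \<in> carrier R" by (rule graph_carrier(1)[OF X x(2)])
      have "can a \<otimes>\<^bsub>S\<^esub> X \<in> P"
        unfolding can_mult_graph[OF X x(2)] using x(1) unfolding contraction_def by simp
      then show "X \<in> P"
        using P.I_prime[OF can_closed[OF ac] X] a(2) ac unfolding contraction_def by simp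
    qed
    show "P \<subseteq> loc_ideal R F (contraction P)"
    proof
      fix X assume XP: "X \<in> P"
      have X: "X \<in> carrier S" by (rule P.Icarr[OF XP])
      obtain I where I: "I \<in> F" "\<forall>a\<in>I. \<exists>x. (a, x) \<in> graph X" using graph_domain[OF X] .
      have "\<exists>x\<in>contraction P. (a, x) \<in> graph X" if a: "a \<in> I" for a
      proof -
        obtain x where x: "(a, x) \<in> graph X" using I(2) a by auto
        note c = graph_carrier[OF X x]
        have "can x \<in> P"
          unfolding can_mult_graph[OF X x, symmetric] by (rule P.I_l_closed[OF XP can_closed[OF c(1)]])
        then show ?thesis unfolding contraction_def using x c(2) by auto
      qed
      then show "X \<in> loc_ideal R F (contraction P)" unfolding loc using X I(1) by auto
    qed
  qed
qed

theorem loc_ideal_bij: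
  "bij_betw (loc_ideal R F) {p. primeideal p R \<and> p \<notin> F}
    {P. primeideal P S \<and> P \<notin> loc_system R F}"
proof (rule bij_betw_byWitness[where f' = contraction])
  show "\<forall>p\<in>{p. primeideal p R \<and> p \<notin> F}. contraction (loc_ideal R F p) = p"
    by (simp add: contraction_loc_ideal)
  show "\<forall>P\<in>{P. primeideal P S \<and> P \<notin> loc_system R F}. loc_ideal R F (contraction P) = P"
    by (simp add: loc_ideal_contraction)
  show "loc_ideal R F ` {p. primeideal p R \<and> p \<notin> F} \<subseteq> {P. primeideal P S \<and> P \<notin> loc_system R F}"
    by (rule image_subsetI) (simp add: loc_ideal_prime loc_ideal_not_in_system)
  show "contraction ` {P. primeideal P S \<and> P \<notin> loc_system R F} \<subseteq> {p. primeideal p R \<and> p \<notin> F}"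
    by (rule image_subsetI) (simp add: contraction_prime contraction_not_in_system)
qed

end

theorem theorem4p10:
  fixes R :: "('a, 'b) ring_scheme" and F :: "'a set set"
  assumes "cring R"
    and "finite_type_system R F"
  shows "bij_betw (loc_ideal R F)
    {p. primeideal p R \<and> p \<notin> F}
    {P. primeideal P (loc_ring R F) \<and> P \<notin> loc_system R F}"
proof -
  have "gabriel_topology R F"
    using assms
    by (simp add: gabriel_topology_def gabriel_topology_axioms_def finite_type_system_def)
  then show ?thesis by (rule gabriel_topology.loc_ideal_bij)
qed

end
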